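(* Let $d\ge 1$ and $k$ be integers with $k>d/2$, and let $\Omega\subset\mathbb{R}^d$ be compact. If $g\in\mathbf{C}(\Omega)$ vanishes on $\partial\Omega$, then $g$ is in the uniform closure (on $\Omega$) of the linear span of $\{\phi_{d,k}(|\cdot-z|) : z\in\Omega\}$.
   Context: $|\cdot|$ is the Euclidean norm on $\mathbb{R}^d$, $\partial\Omega$ is the topological boundary of $\Omega$, and $\mathbf{C}(\Omega)$ is the space of real-valued continuous functions on $\Omega$ with the uniform norm. The polyharmonic spline $\phi_{d,k}:[0,\infty)\to\mathbb{R}$ (for integers $d\ge1$, $k>d/2$) is $\phi_{d,k}(r)=r^{2k-d}$ if $d$ is odd, and $\phi_{d,k}(r)=r^{2k-d}\log r$ if $d$ is even (with value $0$ at $r=0$). *)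

theory Defs
  imports "HOL-Analysis.Analysis" "HOL-Library.Function_Algebras"
begin

text \<open>For \<open>2 * k > d\<close> the natural-number subtraction \<open>2 * k - d\<close> is exact and positive.\<close>

definition polyharmonic_spline :: "nat \<Rightarrow> nat \<Rightarrow> real \<Rightarrow> real" where
  "polyharmonic_spline d k r =
     (if odd d then r ^ (2 * k - d)
      else if r = 0 then 0 else r ^ (2 * k - d) * ln r)"

text \<open>For compact \<open>\<Omega>\<close>, the metric space of continuous real functions on \<open>\<Omega>\<close> under the metric
  of the uniform norm. Its points are functions on the whole type that are \<open>undefined\<close> off \<open>\<Omega>\<close>,
  so a function is made an element by \<open>restrict\<close>.\<close>

abbreviation C_space :: "'a::topological_space set \<Rightarrow> ('a \<Rightarrow> real) metric" where
  "C_space \<Omega> \<equiv> cfunspace (top_of_set \<Omega>) euclidean_metric"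

lemma fun_vector_space: "vector_space (\<lambda>(c::real) (f::'a \<Rightarrow> real) x. c * f x)"
  by unfold_locales (auto simp: fun_eq_iff algebra_simps)

definition spline_translates_span :: "nat \<Rightarrow> (real ^ 'n) set \<Rightarrow> (real ^ 'n \<Rightarrow> real) set" where
  "spline_translates_span k \<Omega> =
     module.span (\<lambda>c f x. c * f x)
       ((\<lambda>z x. polyharmonic_spline CARD('n) k (norm (x - z))) ` \<Omega>)"

lemma restrict_in_C_space_iff:
  fixes \<Omega> :: "'a::euclidean_space set"
  assumes "compact \<Omega>"
  shows "restrict f \<Omega> \<in> mspace (C_space \<Omega>) \<longleftrightarrow> continuous_on \<Omega> f"
proof
  assume "restrict f \<Omega> \<in> mspace (C_space \<Omega>)"
  then have "continuous_on \<Omega> (restrict f \<Omega>)" by simp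
  then show "continuous_on \<Omega> f" by (metis continuous_on_cong restrict_apply')
next
  assume f: "continuous_on \<Omega> f"
  then have c: "continuous_on \<Omega> (restrict f \<Omega>)"
    by (metis continuous_on_cong restrict_apply')
  moreover have "bounded (restrict f \<Omega> ` \<Omega>)"
    using assms c compact_continuous_image compact_imp_bounded by blast
  ultimately show "restrict f \<Omega> \<in> mspace (C_space \<Omega>)" by simp
qed

end

theory Submission
  imports Defs "HOL-Real_Asymp.Real_Asymp"
begin

text \<open>
  The spline \<open>\<phi>(|x|)\<close> is, up to a nonzero factor, a fundamental solution of the iterated Laplacian
  \<open>\<Delta>\<^sup>k\<close>. Hence a smooth function \<open>w\<close> with compact support \<open>K\<close> in the interior of \<open>\<Omega>\<close> is a multiple of
  \<open>\<integral> \<phi>(|x - z|) (\<Delta>\<^sup>k w)(z) dz\<close>, an integral over \<open>K\<close> of translates of the spline with centres in \<open>\<Omega>\<close>, and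
  such an integral is a uniform limit of finite sums (\<open>integral_in_uniform_closure_on\<close>). A continuous
  \<open>g\<close> vanishing on the boundary is a uniform limit of functions supported in the interior, and these
  are uniform limits of smooth ones.

  The proof makes this quantitative without distributions. Everything in sight is radial, so a
  function is handled through the successive derivatives of its profile in \<open>t = |x|\<^sup>2\<close>, on
  which the Laplacian acts by an algebraic formula. The singular profile is replaced by the profile
  at \<open>t + e\<close>, and then \<open>\<Delta>\<^sup>k\<close> can be evaluated exactly (\<open>laplacian_power_spline_jet\<close>): for \<open>\<phi>(|x|) = f(|x|\<^sup>2)\<close>,
  \<open>\<Delta>\<^sup>k f(|x|\<^sup>2 + e) = C e\<^sup>k (|x|\<^sup>2 + e)\<close> to the power \<open>- d/2 - k\<close>, with \<open>C \<noteq> 0\<close>. Divided by \<open>C\<close>, the right-hand side is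
  a positive kernel which concentrates at the origin as \<open>e \<rightarrow> 0\<close> while its mass stays bounded
  below, so that its normalised averages of a continuous function converge uniformly to that function
  (\<open>kernel_average_error\<close>). Green's identity (\<open>integral_radial_laplacian_power\<close>) moves \<open>\<Delta>\<^sup>k\<close> to
  the test function. For the test functions \<open>w\<close> it is enough to take the
  radial bumps \<open>max(0, r\<^sup>2 - |x - c|\<^sup>2)\<close> to the power \<open>2k + 2\<close> on balls inside \<open>\<Omega>\<close>
  (\<open>bump_in_spline_closure\<close>), because averaging against the same bumps approximates
  every continuous function supported in the interior (\<open>mollification_in_uniform_closure_on\<close>).
\<close>

section \<open>The Laplacian on radial profiles\<close>

text \<open>A jet \<open>F\<close> lists a function \<open>F 0\<close> of \<open>t\<close> together with its derivatives, so that
  differentiation is a shift of the index and operators with polynomial coefficients become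
  algebraic. The derivatives are two-sided also at \<open>t = 0\<close>.\<close>
definition is_jet :: "nat \<Rightarrow> (nat \<Rightarrow> real \<Rightarrow> real) \<Rightarrow> bool" where
  "is_jet N F \<longleftrightarrow> (\<forall>n<N. \<forall>t\<ge>0. (F n has_real_derivative F (Suc n) t) (at t))"

text \<open>The Laplacian in dimension \<open>d\<close> of \<open>x \<mapsto> F(|x|\<^sup>2)\<close> has the profile \<open>4 t F'' + 2 d F'\<close>. The formula
  is its \<open>n\<close>-th derivative by Leibniz' rule.\<close>
definition jet_laplacian :: "real \<Rightarrow> (nat \<Rightarrow> real \<Rightarrow> real) \<Rightarrow> nat \<Rightarrow> real \<Rightarrow> real" where
  "jet_laplacian d F n t = 4 * t * F (n + 2) t + (4 * real n + 2 * d) * F (n + 1) t"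

text \<open>The first-order operator \<open>F \<mapsto> 4 t F' + 2 a F\<close>, again with all its derivatives. The Laplacian is
  this operator for \<open>a = d\<close> applied to \<open>F'\<close>.\<close>
definition jet_euler :: "real \<Rightarrow> (nat \<Rightarrow> real \<Rightarrow> real) \<Rightarrow> nat \<Rightarrow> real \<Rightarrow> real" where
  "jet_euler a F n t = 4 * t * F (n + 1) t + (4 * real n + 2 * a) * F n t"

primrec jet_euler_prod :: "real \<Rightarrow> nat \<Rightarrow> (nat \<Rightarrow> real \<Rightarrow> real) \<Rightarrow> nat \<Rightarrow> real \<Rightarrow> real" where
  "jet_euler_prod d 0 F = F"
| "jet_euler_prod d (Suc j) F = jet_euler (d + 2 * real j) (jet_euler_prod d j F)"

lemma jet_euler_commute: "jet_euler a (jet_euler b F) = jet_euler b (jet_euler a F)"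
  by (intro ext) (simp add: jet_euler_def algebra_simps)

lemma jet_euler_prod_rec:
  "jet_euler_prod d (Suc j) F = jet_euler d (jet_euler_prod (d + 2) j F)"
proof (induction j)
  case (Suc j)
  have "jet_euler_prod d (Suc (Suc j)) F
      = jet_euler (d + 2 * real (Suc j)) (jet_euler d (jet_euler_prod (d + 2) j F))"
    using Suc by simp
  also have "\<dots> = jet_euler d (jet_euler (d + 2 + 2 * real j) (jet_euler_prod (d + 2) j F))"
    by (subst jet_euler_commute) (simp add: algebra_simps)
  finally show ?case by simp
qed simp

text \<open>Differentiation turns the operator with parameter \<open>a\<close> into the one with parameter \<open>a + 2\<close>.\<close>
lemma jet_euler_prod_shift:
  "(\<lambda>n. jet_euler_prod d j F (Suc n)) = jet_euler_prod (d + 2) j (\<lambda>n. F (Suc n))"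
proof (induction j)
  case (Suc j)
  have "(\<lambda>n. jet_euler_prod d (Suc j) F (Suc n))
      = jet_euler (d + 2 + 2 * real j) (\<lambda>n. jet_euler_prod d j F (Suc n))"
    by (intro ext) (simp add: jet_euler_def algebra_simps)
  then show ?case
    by (simp add: Suc)
qed simp

lemma jet_laplacian_eq_euler: "jet_laplacian d F = jet_euler d (\<lambda>n. F (Suc n))"
  by (intro ext) (simp add: jet_laplacian_def jet_euler_def)

text \<open>Since \<open>\<Delta>\<close> is an Euler operator after a differentiation, all \<open>k\<close> differentiations can be moved
  to the right, past Euler operators whose parameters grow by 2 each time. So \<open>\<Delta>\<^sup>k f\<close>
  depends on \<open>f\<close> only through its \<open>k\<close>-th derivative, which for the spline is a pure power.\<close>
lemma jet_laplacian_power: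
  "(jet_laplacian d ^^ k) F = jet_euler_prod d k (\<lambda>n. F (n + k))"
proof (induction k)
  case (Suc k)
  have "(jet_laplacian d ^^ Suc k) F
      = jet_euler d (\<lambda>n. jet_euler_prod d k (\<lambda>n. F (n + k)) (Suc n))"
    by (simp add: Suc jet_laplacian_eq_euler)
  also have "\<dots> = jet_euler_prod d (Suc k) (\<lambda>n. F (n + Suc k))"
    by (simp only: jet_euler_prod_shift jet_euler_prod_rec) simp
  finally show ?case .
qed simp

text \<open>The operator \<open>4 t D + 2 a\<close> with \<open>a = 2 s\<close> sends \<open>(t + e)\<close> to the power \<open>- s\<close> to the multiple
  \<open>4 e s\<close> of the next power \<open>- s - 1\<close>: the terms free of \<open>e\<close> cancel. Because the Euler operators
  commute, they can be applied in the order in which this cancellation takes place every time.\<close>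
lemma jet_euler_prod_powr:
  fixes s e t :: real
  assumes "t + e > 0"
    and "\<And>n. G n t = c * (-1) ^ n * pochhammer s n * (t + e) powr (- s - real n)"
  shows "jet_euler_prod (2 * s) j G n t
       = c * (4 * e) ^ j * pochhammer s j *
         ((-1) ^ n * pochhammer (s + real j) n * (t + e) powr (- s - real j - real n))"
proof (induction j arbitrary: n)
  case 0
  then show ?case using assms(2)[of n] by simp
next
  case (Suc j)
  define q where "q = (t + e) powr (- s - real j - real n - 1)"
  have q: "(t + e) powr (- s - real j - real n) = (t + e) * q"
    using assms(1) by (simp add: q_def powr_diff)
  have q': "(t + e) powr (- s - real j - real (n + 1)) = q"
           "(t + e) powr (- s - real (Suc j) - real n) = q"
    by (simp_all add: q_def algebra_simps)
  define p where "p = pochhammer (s + real j) n"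
  have p: "pochhammer (s + real j) (n + 1) = p * (s + real j + real n)"
    by (simp add: pochhammer_Suc p_def)
  have p': "(s + real j) * pochhammer (s + real (Suc j)) n = p * (s + real j + real n)"
    using pochhammer_rec[of "s + real j" n] p by (simp add: algebra_simps)
  have "jet_euler_prod (2 * s) (Suc j) G n t
      = 4 * t * (c * (4 * e) ^ j * pochhammer s j * ((-1) ^ (n + 1) * (p * (s + real j + real n)) * q))
        + (4 * real n + 2 * (2 * s + 2 * real j)) *
          (c * (4 * e) ^ j * pochhammer s j * ((-1) ^ n * p * ((t + e) * q)))"
    unfolding jet_euler_prod.simps jet_euler_def Suc q q' p p_def[symmetric] ..
  also have "\<dots> = c * (4 * e) ^ Suc j * pochhammer s j *
       ((-1) ^ n * (p * (s + real j + real n)) * q)"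
    by (simp add: algebra_simps)
  also have "\<dots> = c * (4 * e) ^ Suc j * pochhammer s (Suc j) *
       ((-1) ^ n * pochhammer (s + real (Suc j)) n * q)"
    unfolding p'[symmetric] pochhammer_Suc by (simp add: algebra_simps)
  finally show ?case by (simp only: q')
qed

lemma is_jet_laplacian:
  assumes "is_jet (N + 2) F" shows "is_jet N (jet_laplacian d F)"
  unfolding is_jet_def
proof (intro allI impI)
  fix n t :: real and m assume "m < N" "t \<ge> 0"
  then have [derivative_intros]:
    "(F (m + 2) has_real_derivative F (m + 3) t) (at t)"
    "(F (m + 1) has_real_derivative F (m + 2) t) (at t)"
    using assms unfolding is_jet_def
    by (auto simp: numeral_eq_Suc)
  have "((\<lambda>t. 4 * t * F (m + 2) t + (4 * real m + 2 * d) * F (m + 1) t)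
        has_real_derivative jet_laplacian d F (Suc m) t) (at t)"
    by (rule derivative_eq_intros refl)+
       (simp add: jet_laplacian_def algebra_simps numeral_eq_Suc)
  then show "(jet_laplacian d F m has_real_derivative jet_laplacian d F (Suc m) t) (at t)"
    unfolding jet_laplacian_def[of d F m, abs_def] .
qed

lemma is_jet_mono: "is_jet N F \<Longrightarrow> M \<le> N \<Longrightarrow> is_jet M F"
  by (auto simp: is_jet_def)

lemma is_jet_laplacian_power:
  "is_jet (N + 2 * k) F \<Longrightarrow> is_jet N ((jet_laplacian d ^^ k) F)"
proof (induction k arbitrary: N)
  case (Suc k)
  then have "is_jet (N + 2) ((jet_laplacian d ^^ k) F)"
    by (intro Suc.IH) (simp add: algebra_simps)
  then show ?case by (simp add: is_jet_laplacian)
qed simp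

lemma is_jet_continuous:
  "is_jet N F \<Longrightarrow> n < N \<Longrightarrow> continuous_on {0..} (F n)"
  by (auto simp: is_jet_def intro!: continuous_at_imp_continuous_on DERIV_isCont)

section \<open>The shifted spline profile and its iterated Laplacian\<close>

text \<open>The recursion for the coefficients in the derivatives of \<open>t\<close> to the power \<open>s\<close> times \<open>a + b ln t\<close>. It
  treats odd dimensions (no logarithm) and even ones together.\<close>
definition spline_coeffs :: "real \<Rightarrow> (nat \<Rightarrow> real) \<Rightarrow> (nat \<Rightarrow> real) \<Rightarrow> bool" where
  "spline_coeffs s a b \<longleftrightarrow>
     (\<forall>n. b (Suc n) = (s - real n) * b n \<and> a (Suc n) = (s - real n) * a n + b n)"

definition spline_jet ::
  "real \<Rightarrow> (nat \<Rightarrow> real) \<Rightarrow> (nat \<Rightarrow> real) \<Rightarrow> real \<Rightarrow> nat \<Rightarrow> real \<Rightarrow> real" where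
  "spline_jet s a b e n t = (t + e) powr (s - real n) * (a n + b n * ln (t + e))"

lemma is_jet_spline_jet:
  assumes "spline_coeffs s a b" "e > 0"
  shows "is_jet N (spline_jet s a b e)"
  unfolding is_jet_def
proof (intro allI impI)
  fix n :: nat and t :: real assume "t \<ge> 0"
  then have te: "t + e > 0" using assms by simp
  have ab: "b (Suc n) = (s - real n) * b n" "a (Suc n) = (s - real n) * a n + b n"
    using assms(1) by (auto simp: spline_coeffs_def)
  define q where "q = (t + e) powr (s - real n - 1)"
  have p: "(t + e) powr (s - real n) = q * (t + e)"
    using te by (simp add: powr_diff q_def)
  have "s - real (Suc n) = s - real n - 1" by simp
  then have suc: "spline_jet s a b e (Suc n) t
      = q * ((s - real n) * a n + b n + (s - real n) * b n * ln (t + e))"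
    by (simp only: spline_jet_def q_def ab)
  have "((\<lambda>t. (t + e) powr (s - real n)) has_real_derivative (s - real n) * q) (at t)"
    unfolding q_def using te by (auto intro!: derivative_eq_intros)
  moreover have "((\<lambda>t. a n + b n * ln (t + e)) has_real_derivative b n / (t + e)) (at t)"
    using te by (auto intro!: derivative_eq_intros)
  ultimately have "((\<lambda>t. (t + e) powr (s - real n) * (a n + b n * ln (t + e)))
        has_real_derivative spline_jet s a b e (Suc n) t) (at t)"
    by (rule DERIV_cong[OF DERIV_mult], unfold suc p) (use te in \<open>simp add: field_simps\<close>)
  then show "(spline_jet s a b e n has_real_derivative spline_jet s a b e (Suc n) t) (at t)"
    unfolding spline_jet_def[of s a b e n, abs_def] .
qed

text \<open>After \<open>k\<close> derivatives the logarithm is gone and a nonzero multiple of a pure power remains. In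
  odd dimensions the exponent \<open>s = k - d/2\<close> is not an integer, so no factor \<open>s - i\<close> vanishes. In even
  dimensions \<open>s < k\<close> is a natural number: the derivative of order \<open>s + 1\<close> kills the polynomial
  factor of the logarithm, and what differentiating the logarithm leaves behind stays nonzero.\<close>
lemma spline_coeffs_exist:
  fixes d k :: nat
  assumes "2 * k > d" "d > 0"
  obtains a b where "spline_coeffs (real k - real d / 2) a b" "b k = 0" "a k \<noteq> 0"
    "\<And>r. r \<ge> 0 \<Longrightarrow> polyharmonic_spline d k r = (r\<^sup>2) powr (real k - real d / 2) * (a 0 + b 0 * ln (r\<^sup>2))"
proof -
  define s where "s = real k - real d / 2"
  have pw: "(r\<^sup>2) powr s = r ^ (2 * k - d)" if "r \<ge> 0" for r :: real
  proof (cases "r = 0")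
    case True
    then show ?thesis using assms by (simp add: zero_power)
  next
    case False
    then have "(r\<^sup>2) powr s = r powr (2 * s)"
      using that by (metis powr_powr powr_numeral order_le_less)
    also have "2 * s = real (2 * k - d)"
      using assms by (simp add: s_def of_nat_diff)
    finally show ?thesis using False that by (simp add: powr_realpow)
  qed
  show ?thesis
  proof (cases "odd d")
    case True
    define a where "a = (\<lambda>n. \<Prod>i<n. s - real i)"
    have "s \<noteq> real i" for i
    proof
      assume "s = real i"
      then have "real d = real (2 * k) - real (2 * i)" by (simp add: s_def)
      then have "real (d + 2 * i) = real (2 * k)" by simp
      then have "d + 2 * i = 2 * k" by (simp only: of_nat_eq_iff)
      with True show False by presburger
    qed
    then have "a k \<noteq> 0" by (simp add: a_def)
    moreover have "spline_coeffs s a (\<lambda>_. 0)"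
      by (simp add: spline_coeffs_def a_def)
    ultimately show ?thesis
      using that[of a "\<lambda>_. 0"] True pw by (simp add: s_def polyharmonic_spline_def a_def)
  next
    case False
    define p where "p = k - d div 2"
    have dk: "d = 2 * (d div 2)" using False by simp
    have sp: "s = real p" 
    proof -
      have "real d = 2 * real (d div 2)" using dk by (metis of_nat_mult of_nat_numeral)
      then show ?thesis using assms dk by (simp add: s_def p_def of_nat_diff)
    qed
    have pk: "p < k" using assms dk unfolding p_def by linarith
    define b where "b = (\<lambda>n. (\<Prod>i<n. s - real i) / 2)"
    define a where "a = rec_nat 0 (\<lambda>n x. (s - real n) * x + b n)"
    have a: "a 0 = 0" "\<And>n. a (Suc n) = (s - real n) * a n + b n" by (simp_all add: a_def)
    have bz: "b n = 0" if "n > p" for n using that by (auto simp: b_def sp)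
    have "a (Suc p) = b p" using a(2)[of p] by (simp add: sp)
    also have "b p \<noteq> 0" by (auto simp: b_def sp)
    finally have a1: "a (Suc p) \<noteq> 0" .
    have az: "a n \<noteq> 0" if "n \<ge> Suc p" for n
      using that
    proof (induction n rule: dec_induct)
      case base then show ?case using a1 .
    next
      case (step n)
      then show ?case using bz[of n] by (simp add: a(2) sp)
    qed
    have "spline_coeffs s a b"
      by (simp add: spline_coeffs_def a b_def)
    moreover have "polyharmonic_spline d k r = (r\<^sup>2) powr s * (a 0 + b 0 * ln (r\<^sup>2))"
      if "r \<ge> 0" for r :: real
      unfolding pw[OF that] using False that assms
      by (auto simp: polyharmonic_spline_def a b_def ln_realpow)
    ultimately show ?thesis
      using that[of a b] az[of k] bz[of k] pk by (simp add: s_def)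
  qed
qed

lemma spline_coeffs_tail:
  assumes "spline_coeffs s a b" "b k = 0"
  shows "b (k + n) = 0" "a (n + k) = a k * (-1) ^ n * pochhammer (real k - s) n"
proof -
  show b: "b (k + n) = 0" for n
    using assms by (induction n) (auto simp: spline_coeffs_def)
  show "a (n + k) = a k * (-1) ^ n * pochhammer (real k - s) n"
  proof (induction n)
    case (Suc n)
    have "a (Suc n + k) = (s - real (n + k)) * a (n + k)"
      using assms(1) b[of n] unfolding spline_coeffs_def by (simp add: add.commute)
    then show ?case unfolding Suc by (simp add: pochhammer_Suc algebra_simps)
  qed simp
qed

text \<open>At \<open>e = 0\<close> the right-hand side vanishes away from the origin, as it must for a fundamental solution; the
  shift spreads the point mass into a positive kernel with a coefficient that is visibly nonzero
  when \<open>a k\<close> is.\<close>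
lemma laplacian_power_spline_jet:
  fixes d k :: nat
  assumes ab: "spline_coeffs (real k - real d / 2) a b" "b k = 0" and te: "t + e > 0"
  shows "(jet_laplacian d ^^ k) (spline_jet (real k - real d / 2) a b e) 0 t
       = a k * 4 ^ k * pochhammer (real d / 2) k * (e ^ k * (t + e) powr (- real d / 2 - real k))"
proof -
  have "jet_euler_prod (2 * (real d / 2)) k
          (\<lambda>n. spline_jet (real k - real d / 2) a b e (n + k)) 0 t
      = a k * (4 * e) ^ k * pochhammer (real d / 2) k * ((-1) ^ 0 *
        pochhammer (real d / 2 + real k) 0 * (t + e) powr (- (real d / 2) - real k - real 0))"
  proof (rule jet_euler_prod_powr[OF te])
    fix n
    show "spline_jet (real k - real d / 2) a b e (n + k) t =
         a k * (- 1) ^ n * pochhammer (real d / 2) n * (t + e) powr (- (real d / 2) - real n)"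
      using spline_coeffs_tail[OF ab, of n]
      by (simp add: spline_jet_def add.commute[of n k] diff_diff_eq)
  qed
  then show ?thesis by (simp add: jet_laplacian_power power_mult_distrib)
qed

lemma continuous_spline_profile:
  fixes s :: real assumes "s > 0"
  shows "continuous_on {0..} (\<lambda>t. t powr s * (a + b * ln t))"
  unfolding continuous_on_def
proof
  fix t :: real assume t: "t \<in> {0..}"
  show "((\<lambda>t. t powr s * (a + b * ln t)) \<longlongrightarrow> t powr s * (a + b * ln t)) (at t within {0..})"
  proof (cases "t = 0")
    case True
    have "((\<lambda>t. t powr s * (a + b * ln t)) \<longlongrightarrow> 0) (at_right 0)"
      using assms by real_asymp
    moreover have "at (0::real) within {0..} = at_right 0"
      by (rule at_within_Ici_at_right)
    ultimately show ?thesis using True by simp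
  next
    case False
    then show ?thesis using t by (intro tendsto_intros) auto
  qed
qed

section \<open>Green's identity for radial functions\<close>

lemma integrable_compact_support:
  fixes f :: "'a::euclidean_space \<Rightarrow> real"
  assumes "continuous_on K f" "compact K" "\<And>x. x \<notin> K \<Longrightarrow> f x = 0"
  shows "integrable lborel f"
proof -
  have "(\<lambda>x. indicator K x *\<^sub>R f x) = f"
    using assms(3) by (auto simp: fun_eq_iff indicator_def)
  with borel_integrable_compact[OF assms(2,1)] show ?thesis by simp
qed

lemma integral_lborel_translate:
  fixes f :: "'a::euclidean_space \<Rightarrow> real"
  assumes "f \<in> borel_measurable borel"
  shows "(\<integral>x. f (c + x) \<partial>lborel) = (\<integral>x. f x \<partial>lborel)"
proof -
  have "(\<integral>x. f x \<partial>distr lborel borel ((+) c)) = (\<integral>x. f (c + x) \<partial>lborel)"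
    using assms by (intro integral_distr) auto
  then show ?thesis by (simp add: lborel_distr_plus)
qed

text \<open>Difference quotients of \<open>G\<close> integrate to zero by translation invariance, and they converge to the
  derivative boundedly and with support in a fixed ball. No integration
  in single coordinates is involved.\<close>
lemma integral_directional_derivative_eq_0:
  fixes G G' :: "'a::euclidean_space \<Rightarrow> real"
  assumes G: "continuous_on UNIV G" "continuous_on UNIV G'"
    and deriv: "\<And>z t. ((\<lambda>t. G (z + t *\<^sub>R b)) has_real_derivative G' (z + t *\<^sub>R b)) (at t)"
    and supp: "\<And>z. R < norm z \<Longrightarrow> G z = 0" "\<And>z. R < norm z \<Longrightarrow> G' z = 0"
    and b: "norm b = 1"
  shows "(\<integral>z. G' z \<partial>lborel) = 0"
proof -
  define h where "h n = 1 / real (Suc n)" for n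
  have h: "0 < h n" "h n \<le> 1" for n by (simp_all add: h_def)
  define s where "s n z = (G (h n *\<^sub>R b + z) - G z) / h n" for n z
  have [measurable]: "G \<in> borel_measurable borel" "G' \<in> borel_measurable borel"
    using G by (auto intro: borel_measurable_continuous_onI)
  have intG: "integrable lborel G"
    by (rule integrable_compact_support[of "cball 0 R"])
       (use G supp in \<open>auto intro: continuous_on_subset\<close>)
  have "integrable lborel (\<lambda>z. G (h n *\<^sub>R b + z))" for n
    using intG integrable_distr_eq[of "(+) (h n *\<^sub>R b)" lborel borel G]
    by (simp add: lborel_distr_plus)
  then have s0: "(\<integral>z. s n z \<partial>lborel) = 0" for n
    unfolding s_def using intG by (simp add: integral_lborel_translate)
  have "bounded (G' ` cball 0 R)"
    using G(2) by (intro compact_imp_bounded compact_continuous_image continuous_on_subset[OF G(2)]) auto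
  then obtain M where M: "\<And>z. z \<in> cball 0 R \<Longrightarrow> \<bar>G' z\<bar> \<le> M" "M > 0"
    unfolding bounded_pos by (metis imageI real_norm_def)
  have M': "\<bar>G' z\<bar> \<le> M" for z
    using M(1)[of z] supp(2)[of z] M(2) by (cases "norm z \<le> R") auto
  have "(\<lambda>n. \<integral>z. s n z \<partial>lborel) \<longlonglongrightarrow> (\<integral>z. G' z \<partial>lborel)"
  proof (rule integral_dominated_convergence)
    show "integrable lborel (\<lambda>z. indicator (cball 0 (R + 1)) z *\<^sub>R M)"
      by (rule borel_integrable_compact) auto
    show "AE z in lborel. (\<lambda>n. s n z) \<longlonglongrightarrow> G' z"
    proof (rule AE_I2)
      fix z
      have "((\<lambda>t. (G (z + (0 + t) *\<^sub>R b) - G (z + 0 *\<^sub>R b)) / t) \<longlongrightarrow> G' (z + 0 *\<^sub>R b)) (at 0)"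
        using DERIV_D[OF deriv[of z 0]] .
      moreover have "filterlim h (at 0) sequentially"
        unfolding filterlim_at
      proof
        show "h \<longlonglongrightarrow> 0" unfolding h_def by real_asymp
      qed (use h(1) in \<open>auto simp: less_imp_neq[symmetric] intro!: always_eventually\<close>)
      ultimately have "(\<lambda>n. (G (z + (0 + h n) *\<^sub>R b) - G (z + 0 *\<^sub>R b)) / h n) \<longlonglongrightarrow> G' (z + 0 *\<^sub>R b)"
        by (rule filterlim_compose)
      then show "(\<lambda>n. s n z) \<longlonglongrightarrow> G' z"
        by (simp add: s_def add.commute)
    qed
    show "AE z in lborel. norm (s n z) \<le> indicator (cball 0 (R + 1)) z *\<^sub>R M" for n
    proof (rule AE_I2)
      fix z
      obtain \<xi> where \<xi>: "0 < \<xi>" "\<xi> < h n"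
        "G (z + h n *\<^sub>R b) - G (z + 0 *\<^sub>R b) = (h n - 0) * G' (z + \<xi> *\<^sub>R b)"
        using MVT2[of 0 "h n" "\<lambda>t. G (z + t *\<^sub>R b)" "\<lambda>t. G' (z + t *\<^sub>R b)"] h(1) deriv by blast
      then have eq: "s n z = G' (z + \<xi> *\<^sub>R b)"
        using h(1)[of n] by (simp add: s_def field_simps)
      show "norm (s n z) \<le> indicator (cball 0 (R + 1)) z *\<^sub>R M"
      proof (cases "norm z \<le> R + 1")
        case True
        then show ?thesis using M' by (simp add: eq)
      next
        case False
        have "norm z \<le> norm (z + \<xi> *\<^sub>R b) + norm (\<xi> *\<^sub>R b)"
          by (metis add_diff_cancel norm_triangle_ineq4)
        then have "R < norm (z + \<xi> *\<^sub>R b)"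
          using False \<xi>(1,2) h(2)[of n] b by simp
        then show ?thesis using supp(2) M(2) by (simp add: eq)
      qed
    qed
  qed (simp_all add: s_def)
  then have "(\<lambda>n. 0) \<longlonglongrightarrow> (\<integral>z. G' z \<partial>lborel)" by (simp add: s0)
  then show ?thesis by (simp add: LIMSEQ_const_iff)
qed

lemma radial_directional_derivative:
  fixes x z b :: "'a::euclidean_space"
  assumes "is_jet N F" "n < N"
  shows "((\<lambda>t. F n ((norm (z + t *\<^sub>R b - x))\<^sup>2)) has_real_derivative
           2 * ((z + t *\<^sub>R b - x) \<bullet> b) * F (Suc n) ((norm (z + t *\<^sub>R b - x))\<^sup>2)) (at t)"
proof -
  have q: "((\<lambda>t. (norm (z + t *\<^sub>R b - x))\<^sup>2) has_real_derivative 2 * ((z + t *\<^sub>R b - x) \<bullet> b)) (at t)"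
  proof -
    have "(norm (z + t *\<^sub>R b - x))\<^sup>2 = (z - x) \<bullet> (z - x) + 2 * t * ((z - x) \<bullet> b) + t\<^sup>2 * (b \<bullet> b)" for t
      by (simp only: power2_norm_eq_inner) (simp add: algebra_simps inner_commute power2_eq_square)
    moreover have "((\<lambda>t. (z - x) \<bullet> (z - x) + 2 * t * ((z - x) \<bullet> b) + t\<^sup>2 * (b \<bullet> b))
       has_real_derivative 2 * ((z + t *\<^sub>R b - x) \<bullet> b)) (at t)"
      by (auto intro!: derivative_eq_intros simp: algebra_simps)
    ultimately show ?thesis by simp
  qed
  have "(F n has_real_derivative F (Suc n) ((norm (z + t *\<^sub>R b - x))\<^sup>2)) (at ((norm (z + t *\<^sub>R b - x))\<^sup>2))"
    using assms by (simp add: is_jet_def)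
  from DERIV_chain2[OF this q] show ?thesis by (simp add: mult.commute)
qed

lemma continuous_radial:
  assumes "continuous_on {0..} f"
  shows "continuous_on UNIV (\<lambda>z::'a::euclidean_space. f ((norm (z - x))\<^sup>2))"
  by (rule continuous_on_compose2[OF assms]) (auto intro!: continuous_intros)

text \<open>The second derivative in direction \<open>b\<close>, for \<open>|b| = 1\<close>, of \<open>y \<mapsto> F(|y|\<^sup>2)\<close>.\<close>
definition radial_second_derivative :: "'a::euclidean_space \<Rightarrow> (nat \<Rightarrow> real \<Rightarrow> real) \<Rightarrow> 'a \<Rightarrow> real" where
  "radial_second_derivative b F y = 2 * F 1 ((norm y)\<^sup>2) + 4 * (y \<bullet> b)\<^sup>2 * F 2 ((norm y)\<^sup>2)"

lemma sum_radial_second_derivative: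
  "(\<Sum>b\<in>Basis. radial_second_derivative b F (y::'a::euclidean_space))
    = jet_laplacian (real DIM('a)) F 0 ((norm y)\<^sup>2)"
proof -
  have "(\<Sum>b\<in>Basis. (y \<bullet> b)\<^sup>2) = (norm y)\<^sup>2"
    using euclidean_inner[of y y] by (simp only: power2_norm_eq_inner) (simp add: power2_eq_square)
  then show ?thesis
    by (simp add: radial_second_derivative_def sum.distrib jet_laplacian_def numeral_2_eq_2
        flip: sum_distrib_left sum_distrib_right)
qed

lemma integral_radial_by_parts:
  fixes x c b :: "'a::euclidean_space"
  assumes F: "is_jet 3 F" and W: "is_jet 3 W" and b: "norm b = 1"
    and supp: "\<And>n t. n \<le> 2 \<Longrightarrow> t \<ge> r\<^sup>2 \<Longrightarrow> W n t = 0" and r: "r > 0"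
  shows "integrable lborel (\<lambda>z. F 0 ((norm (z - x))\<^sup>2) * radial_second_derivative b W (z - c))"
    and "integrable lborel (\<lambda>z. radial_second_derivative b F (z - x) * W 0 ((norm (z - c))\<^sup>2))"
    and "(\<integral>z. F 0 ((norm (z - x))\<^sup>2) * radial_second_derivative b W (z - c) \<partial>lborel)
       = (\<integral>z. radial_second_derivative b F (z - x) * W 0 ((norm (z - c))\<^sup>2) \<partial>lborel)"
proof -
  have cF: "continuous_on UNIV (\<lambda>z::'a. F n ((norm (z - x))\<^sup>2))" if "n < 3" for n
    using continuous_radial is_jet_continuous[OF F that] by blast
  have cW: "continuous_on UNIV (\<lambda>z::'a. W n ((norm (z - c))\<^sup>2))" if "n < 3" for n
    using continuous_radial is_jet_continuous[OF W that] by blast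
  have W0: "W n ((norm (z - c))\<^sup>2) = 0" if "n \<le> 2" "z \<notin> cball c r" for n z
    using that r by (intro supp power_mono) (auto simp: dist_norm norm_minus_commute)
  have cF2: "continuous_on UNIV (\<lambda>z. radial_second_derivative b F (z - x))"
    and cW2: "continuous_on UNIV (\<lambda>z. radial_second_derivative b W (z - c))"
    unfolding radial_second_derivative_def by (intro continuous_intros cF cW; simp)+
  show i1: "integrable lborel (\<lambda>z. F 0 ((norm (z - x))\<^sup>2) * radial_second_derivative b W (z - c))"
  proof (rule integrable_compact_support[of "cball c r"])
    show "continuous_on (cball c r) (\<lambda>z. F 0 ((norm (z - x))\<^sup>2) * radial_second_derivative b W (z - c))"
      by (rule continuous_on_subset[OF _ subset_UNIV]) (intro continuous_intros cF cW2; simp)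
  qed (auto simp: radial_second_derivative_def W0)
  show i2: "integrable lborel (\<lambda>z. radial_second_derivative b F (z - x) * W 0 ((norm (z - c))\<^sup>2))"
  proof (rule integrable_compact_support[of "cball c r"])
    show "continuous_on (cball c r) (\<lambda>z. radial_second_derivative b F (z - x) * W 0 ((norm (z - c))\<^sup>2))"
      by (rule continuous_on_subset[OF _ subset_UNIV]) (intro continuous_intros cF2 cW; simp)
  qed (auto simp: W0)
  \<comment> \<open>Green's identity in one direction: the derivative of \<open>v w' - v' w\<close> is \<open>v w'' - v'' w\<close>.\<close>
  define G where "G z = F 0 ((norm (z - x))\<^sup>2) * (2 * ((z - c) \<bullet> b) * W 1 ((norm (z - c))\<^sup>2))
      - (2 * ((z - x) \<bullet> b) * F 1 ((norm (z - x))\<^sup>2)) * W 0 ((norm (z - c))\<^sup>2)" for z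
  define G' where "G' z = F 0 ((norm (z - x))\<^sup>2) * radial_second_derivative b W (z - c)
      - radial_second_derivative b F (z - x) * W 0 ((norm (z - c))\<^sup>2)" for z
  have bb: "b \<bullet> b = 1" using b by (simp add: norm_eq_1)
  have "(\<integral>z. G' z \<partial>lborel) = 0"
  proof (rule integral_directional_derivative_eq_0[where G = G and R = "norm c + r" and b = b])
    show "continuous_on UNIV G" unfolding G_def
      by (intro continuous_intros cF cW) auto
    show "continuous_on UNIV G'" unfolding G'_def
      by (intro continuous_intros cF cW cF2 cW2) auto
    have "z \<notin> cball c r" if "norm c + r < norm z" for z
      using that norm_triangle_ineq2[of z c] by (auto simp: dist_norm norm_minus_commute)
    then show "G z = 0" "G' z = 0" if "norm c + r < norm z" for z
      using that W0 by (simp_all add: G_def G'_def radial_second_derivative_def)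
    fix z t
    let ?y = "z + t *\<^sub>R b"
    have lin: "((\<lambda>t. 2 * ((z + t *\<^sub>R b - y) \<bullet> b)) has_real_derivative 2) (at t)" for y
      by (auto intro!: derivative_eq_intros simp: inner_diff_left inner_add_left bb)
    have dF: "((\<lambda>t. F n ((norm (z + t *\<^sub>R b - x))\<^sup>2)) has_real_derivative
        2 * ((?y - x) \<bullet> b) * F (Suc n) ((norm (?y - x))\<^sup>2)) (at t)" if "n < 3" for n
      using radial_directional_derivative[OF F that] .
    have dW: "((\<lambda>t. W n ((norm (z + t *\<^sub>R b - c))\<^sup>2)) has_real_derivative
        2 * ((?y - c) \<bullet> b) * W (Suc n) ((norm (?y - c))\<^sup>2)) (at t)" if "n < 3" for n
      using radial_directional_derivative[OF W that] .
    show "((\<lambda>t. G (z + t *\<^sub>R b)) has_real_derivative G' (z + t *\<^sub>R b)) (at t)"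
      unfolding G_def
      by (rule DERIV_cong[OF DERIV_diff[OF
            DERIV_mult[OF dF[of 0] DERIV_mult[OF lin[of c] dW[of 1]]]
            DERIV_mult[OF DERIV_mult[OF lin[of x] dF[of 1]] dW[of 0]]]])
         (simp_all add: G'_def radial_second_derivative_def numeral_2_eq_2 algebra_simps)
  qed (fact b)
  then show "(\<integral>z. F 0 ((norm (z - x))\<^sup>2) * radial_second_derivative b W (z - c) \<partial>lborel)
       = (\<integral>z. radial_second_derivative b F (z - x) * W 0 ((norm (z - c))\<^sup>2) \<partial>lborel)"
    unfolding G'_def using i1 i2 by simp
qed

lemma integral_radial_laplacian:
  fixes x c :: "'a::euclidean_space"
  assumes F: "is_jet 3 F" and W: "is_jet 3 W"
    and supp: "\<And>n t. n \<le> 2 \<Longrightarrow> t \<ge> r\<^sup>2 \<Longrightarrow> W n t = 0" and r: "r > 0"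
  shows "(\<integral>z. F 0 ((norm (z - x))\<^sup>2) * jet_laplacian DIM('a) W 0 ((norm (z - c))\<^sup>2) \<partial>lborel)
       = (\<integral>z. jet_laplacian DIM('a) F 0 ((norm (z - x))\<^sup>2) * W 0 ((norm (z - c))\<^sup>2) \<partial>lborel)"
proof -
  note P = integral_radial_by_parts[OF F W norm_Basis supp r, simplified]
  show ?thesis
    unfolding sum_radial_second_derivative[symmetric] sum_distrib_left sum_distrib_right
    by (subst (1 2) Bochner_Integration.integral_sum) (auto intro!: sum.cong P)
qed

lemma integral_radial_laplacian_power:
  fixes x c :: "'a::euclidean_space"
  assumes F: "is_jet (2 * k + 1) F" and W: "is_jet (2 * k + 1) W"
    and supp: "\<And>n t. n \<le> 2 * k \<Longrightarrow> t \<ge> r\<^sup>2 \<Longrightarrow> W n t = 0" and r: "r > 0"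
  shows "(\<integral>z. F 0 ((norm (z - x))\<^sup>2) * (jet_laplacian DIM('a) ^^ k) W 0 ((norm (z - c))\<^sup>2) \<partial>lborel)
       = (\<integral>z. (jet_laplacian DIM('a) ^^ k) F 0 ((norm (z - x))\<^sup>2) * W 0 ((norm (z - c))\<^sup>2) \<partial>lborel)"
  using assms(1-3)
proof (induction k arbitrary: F W)
  case (Suc k)
  let ?L = "jet_laplacian (real DIM('a))"
  have supp': "?L W n t = 0" if "n \<le> 2 * k" "t \<ge> r\<^sup>2" for n t
    using that Suc.prems(3) by (simp add: jet_laplacian_def)
  have "(\<integral>z. F 0 ((norm (z - x))\<^sup>2) * (?L ^^ Suc k) W 0 ((norm (z - c))\<^sup>2) \<partial>lborel)
      = (\<integral>z. (?L ^^ k) F 0 ((norm (z - x))\<^sup>2) * ?L W 0 ((norm (z - c))\<^sup>2) \<partial>lborel)"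
    using Suc.IH[of F "?L W"] supp' Suc.prems
    by (simp add: funpow_Suc_right is_jet_laplacian is_jet_mono del: funpow.simps)
  also have "\<dots> = (\<integral>z. (?L ^^ Suc k) F 0 ((norm (z - x))\<^sup>2) * W 0 ((norm (z - c))\<^sup>2) \<partial>lborel)"
  proof -
    have "is_jet 3 ((?L ^^ k) F)"
      by (rule is_jet_laplacian_power) (use Suc.prems(1) in \<open>simp add: numeral_eq_Suc\<close>)
    moreover have "is_jet 3 W" using Suc.prems(2) by (rule is_jet_mono) simp
    ultimately show ?thesis
      using integral_radial_laplacian[of "(?L ^^ k) F" W r x c] Suc.prems(3) r by simp
  qed
  finally show ?case .
qed simp

section \<open>Averages against a concentrated kernel\<close>

text \<open>Near the centre, where \<open>h\<close> varies by at most \<open>\<eta>\<close>, the kernel may be large; farther out it is at most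
  \<open>\<tau>\<close>. The estimate is relative to the mass \<open>m\<close>, so that dividing by \<open>m\<close> requires only a lower bound for
  it and never its value or limit.\<close>
lemma kernel_average_error:
  fixes \<kappa> h :: "'a::euclidean_space \<Rightarrow> real"
  assumes cont: "continuous_on UNIV \<kappa>" "continuous_on UNIV h"
    and \<kappa>: "\<And>y. \<kappa> y \<ge> 0" "\<And>y. \<rho> < norm y \<Longrightarrow> norm y \<le> R \<Longrightarrow> \<kappa> y \<le> \<tau>" "\<tau> \<ge> 0"
    and h: "\<And>z. \<bar>h z\<bar> \<le> M" "\<And>z. dist x z \<le> \<rho> \<Longrightarrow> \<bar>h z - h x\<bar> \<le> \<eta>" "\<eta> \<ge> 0"
      "\<And>z. dist x z > R \<Longrightarrow> h z = 0"
  defines "m \<equiv> (\<integral>y. indicator (cball 0 R) y * \<kappa> y \<partial>lborel)"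
  shows "\<bar>(\<integral>z. \<kappa> (z - x) * h z \<partial>lborel) - m * h x\<bar>
           \<le> \<eta> * m + 2 * M * \<tau> * measure lborel (cball (0::'a) R)"
proof -
  let ?I = "indicat_real (cball (0::'a) R)"
  have int: "integrable lborel (\<lambda>y. ?I y * f y)" if "continuous_on UNIV f" for f :: "'a \<Rightarrow> real"
    using borel_integrable_compact[of "cball 0 R" f] that by (auto intro: continuous_on_subset)
  have ch: "continuous_on UNIV (\<lambda>y. h (x + y))"
    by (rule continuous_on_compose2[OF cont(2)]) (auto intro!: continuous_intros)
  have c2: "continuous_on UNIV (\<lambda>y. \<kappa> (y - x))"
    by (rule continuous_on_compose2[OF cont(1)]) (auto intro!: continuous_intros)
  have c\<kappa>h: "continuous_on UNIV (\<lambda>y. \<kappa> y * h (x + y))"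
    by (intro continuous_on_mult cont ch)
  have M: "M \<ge> 0" using h(1)[of x] by linarith
  have "(\<integral>z. \<kappa> (z - x) * h z \<partial>lborel) = (\<integral>y. \<kappa> y * h (x + y) \<partial>lborel)"
    using c2 cont
    by (subst integral_lborel_translate[of _ x, symmetric])
       (auto intro!: borel_measurable_continuous_onI continuous_intros)
  also have "\<dots> = (\<integral>y. ?I y * (\<kappa> y * h (x + y)) \<partial>lborel)"
    using h(4) by (intro Bochner_Integration.integral_cong) (auto simp: indicator_def dist_norm)
  finally have "(\<integral>z. \<kappa> (z - x) * h z \<partial>lborel) - m * h x
      = (\<integral>y. ?I y * (\<kappa> y * h (x + y)) \<partial>lborel) - (\<integral>y. ?I y * \<kappa> y * h x \<partial>lborel)"
    by (simp add: m_def)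
  also have "\<dots> = (\<integral>y. ?I y * (\<kappa> y * h (x + y)) - ?I y * \<kappa> y * h x \<partial>lborel)"
    using int[OF cont(1)] int[OF c\<kappa>h] by simp
  finally have eq: "(\<integral>z. \<kappa> (z - x) * h z \<partial>lborel) - m * h x
      = (\<integral>y. ?I y * (\<kappa> y * h (x + y)) - ?I y * \<kappa> y * h x \<partial>lborel)" .
  have "norm (\<integral>y. ?I y * (\<kappa> y * h (x + y)) - ?I y * \<kappa> y * h x \<partial>lborel)
      \<le> (\<integral>y. \<eta> * (?I y * \<kappa> y) + ?I y * (2 * M * \<tau>) \<partial>lborel)"
  proof (rule Bochner_Integration.integral_norm_bound_integral)
    show "integrable lborel (\<lambda>y. ?I y * (\<kappa> y * h (x + y)) - ?I y * \<kappa> y * h x)"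
      using int[OF cont(1)] int[OF c\<kappa>h] by simp
    show "integrable lborel (\<lambda>y. \<eta> * (?I y * \<kappa> y) + ?I y * (2 * M * \<tau>))"
      using int[of \<kappa>] int[of "\<lambda>_. 2 * M * \<tau>"] cont by auto
    fix y
    show "norm (?I y * (\<kappa> y * h (x + y)) - ?I y * \<kappa> y * h x) \<le> \<eta> * (?I y * \<kappa> y) + ?I y * (2 * M * \<tau>)"
    proof (cases "y \<in> cball 0 R")
      case True
      have "\<kappa> y * \<bar>h (x + y) - h x\<bar> \<le> \<eta> * \<kappa> y + 2 * M * \<tau>"
      proof (cases "norm y \<le> \<rho>")
        case True
        then have "\<kappa> y * \<bar>h (x + y) - h x\<bar> \<le> \<eta> * \<kappa> y"
          by (subst mult.commute, intro mult_right_mono h(2) \<kappa>(1)) (simp add: dist_norm)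
        moreover have "0 \<le> 2 * M * \<tau>" using M \<kappa>(3) by simp
        ultimately show ?thesis by linarith
      next
        case False
        have "\<bar>h (x + y) - h x\<bar> \<le> 2 * M" using h(1)[of "x + y"] h(1)[of x] by linarith
        moreover have "\<kappa> y \<le> \<tau>" using False True by (intro \<kappa>(2)) auto
        ultimately have "\<kappa> y * \<bar>h (x + y) - h x\<bar> \<le> 2 * M * \<tau>"
          using mult_mono[of "\<kappa> y" \<tau> "\<bar>h (x + y) - h x\<bar>" "2 * M"] \<kappa>(3)
          by (simp only: mult.commute[of "2 * M" \<tau>] abs_ge_zero)
        moreover have "0 \<le> \<eta> * \<kappa> y" using h(3) \<kappa>(1) by simp
        ultimately show ?thesis by linarith
      qed
      moreover have "\<kappa> y * h (x + y) - \<kappa> y * h x = \<kappa> y * (h (x + y) - h x)"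
        by (simp add: algebra_simps)
      ultimately show ?thesis using True \<kappa>(1)[of y] by (simp add: abs_mult)
    qed simp
  qed
  also have "\<dots> = \<eta> * m + 2 * M * \<tau> * measure lborel (cball (0::'a) R)"
    using int[of \<kappa>] int[of "\<lambda>_. 2 * M * \<tau>"] cont
    by (subst Bochner_Integration.integral_add) (auto simp: m_def)
  finally show ?thesis unfolding eq by simp
qed

lemma kernel_mass_lower_bound:
  fixes \<kappa> :: "'a::euclidean_space \<Rightarrow> real"
  assumes "continuous_on UNIV \<kappa>" "\<And>y. \<kappa> y \<ge> 0" "\<And>y. norm y \<le> r \<Longrightarrow> v \<le> \<kappa> y" "r \<le> R"
  shows "v * measure lborel (cball (0::'a) r) \<le> (\<integral>y. indicator (cball 0 R) y * \<kappa> y \<partial>lborel)"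
proof -
  have "v * measure lborel (cball (0::'a) r) = (\<integral>y. indicator (cball (0::'a) r) y * v \<partial>lborel)"
    by simp
  also have "\<dots> \<le> (\<integral>y. indicator (cball 0 R) y * \<kappa> y \<partial>lborel)"
  proof (rule integral_mono)
    show "integrable lborel (\<lambda>y::'a. indicator (cball 0 r) y * v)"
      using borel_integrable_compact[of "cball (0::'a) r" "\<lambda>_. v"] by simp
    show "integrable lborel (\<lambda>y. indicator (cball 0 R) y * \<kappa> y)"
      using borel_integrable_compact[of "cball 0 R" \<kappa>] assms(1) by (auto intro: continuous_on_subset)
    show "indicator (cball 0 r) y * v \<le> indicator (cball 0 R) y * \<kappa> y" for y :: 'a
      using assms(2)[of y] assms(3)[of y] assms(4) by (auto simp: indicator_def)
  qed
  finally show ?thesis .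
qed

section \<open>Uniform closures of spaces of functions\<close>

abbreviation fun_subspace :: "('a \<Rightarrow> real) set \<Rightarrow> bool" where
  "fun_subspace \<equiv> module.subspace (\<lambda>c f x. c * f x)"

lemma fun_subspaceD:
  assumes "fun_subspace S"
  shows "(\<lambda>x. 0) \<in> S" "f \<in> S \<Longrightarrow> g \<in> S \<Longrightarrow> (\<lambda>x. f x + g x) \<in> S" "f \<in> S \<Longrightarrow> (\<lambda>x. c * f x) \<in> S"
proof -
  interpret vector_space "\<lambda>(c::real) (f::'a \<Rightarrow> real) x. c * f x" by (rule fun_vector_space)
  show "(\<lambda>x. 0) \<in> S" "f \<in> S \<Longrightarrow> g \<in> S \<Longrightarrow> (\<lambda>x. f x + g x) \<in> S" "f \<in> S \<Longrightarrow> (\<lambda>x. c * f x) \<in> S"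
    using subspace_0[OF assms] subspace_add[OF assms, of f g] subspace_scale[OF assms, of f c]
    by (simp_all add: zero_fun_def plus_fun_def)
qed

lemma fun_subspaceI:
  assumes "(\<lambda>x. 0) \<in> S" "\<And>f g. f \<in> S \<Longrightarrow> g \<in> S \<Longrightarrow> (\<lambda>x. f x + g x) \<in> S"
    "\<And>c f. f \<in> S \<Longrightarrow> (\<lambda>x. c * f x) \<in> S"
  shows "fun_subspace S"
proof -
  interpret vector_space "\<lambda>(c::real) (f::'a \<Rightarrow> real) x. c * f x" by (rule fun_vector_space)
  show ?thesis using assms by (intro subspaceI) (simp_all add: zero_fun_def plus_fun_def)
qed

definition uniform_closure_on :: "'a set \<Rightarrow> ('a \<Rightarrow> real) set \<Rightarrow> ('a \<Rightarrow> real) set" where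
  "uniform_closure_on X S = {f. \<forall>\<epsilon>>0. \<exists>s\<in>S. \<forall>x\<in>X. \<bar>f x - s x\<bar> \<le> \<epsilon>}"

lemma uniform_closure_on_superset: "S \<subseteq> uniform_closure_on X S"
  by (force simp: uniform_closure_on_def)

lemma uniform_closure_on_closed:
  assumes "\<And>\<epsilon>. \<epsilon> > 0 \<Longrightarrow> \<exists>g\<in>uniform_closure_on X S. \<forall>x\<in>X. \<bar>f x - g x\<bar> \<le> \<epsilon>"
  shows "f \<in> uniform_closure_on X S"
  unfolding uniform_closure_on_def
proof (intro CollectI allI impI)
  fix \<epsilon> :: real assume e: "\<epsilon> > 0"
  then obtain g where g: "g \<in> uniform_closure_on X S" "\<And>x. x \<in> X \<Longrightarrow> \<bar>f x - g x\<bar> \<le> \<epsilon> / 2"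
    using assms[of "\<epsilon> / 2"] by auto
  then obtain s where "s \<in> S" and s: "\<And>x. x \<in> X \<Longrightarrow> \<bar>g x - s x\<bar> \<le> \<epsilon> / 2"
    using e unfolding uniform_closure_on_def by (auto dest: spec[of _ "\<epsilon> / 2"])
  moreover have "\<bar>f x - s x\<bar> \<le> \<epsilon>" if "x \<in> X" for x
    using g(2)[OF that] s[OF that] by linarith
  ultimately show "\<exists>s\<in>S. \<forall>x\<in>X. \<bar>f x - s x\<bar> \<le> \<epsilon>" by blast
qed

lemma fun_subspace_uniform_closure_on:
  assumes S: "fun_subspace S" shows "fun_subspace (uniform_closure_on X S)"
proof (rule fun_subspaceI)
  show "(\<lambda>x. 0) \<in> uniform_closure_on X S"
    using uniform_closure_on_superset fun_subspaceD(1)[OF S] by blast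
next
  fix f g assume fg: "f \<in> uniform_closure_on X S" "g \<in> uniform_closure_on X S"
  show "(\<lambda>x. f x + g x) \<in> uniform_closure_on X S"
    unfolding uniform_closure_on_def
  proof (intro CollectI allI impI)
    fix \<epsilon> :: real assume "\<epsilon> > 0"
    then have "\<epsilon> / 2 > 0" by simp
    then obtain s t where st: "s \<in> S" "t \<in> S"
      "\<And>x. x \<in> X \<Longrightarrow> \<bar>f x - s x\<bar> \<le> \<epsilon> / 2" "\<And>x. x \<in> X \<Longrightarrow> \<bar>g x - t x\<bar> \<le> \<epsilon> / 2"
      using fg unfolding uniform_closure_on_def by blast
    have "\<bar>f x + g x - (s x + t x)\<bar> \<le> \<epsilon>" if "x \<in> X" for x
      using st(3,4)[OF that] by linarith
    then show "\<exists>u\<in>S. \<forall>x\<in>X. \<bar>f x + g x - u x\<bar> \<le> \<epsilon>"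
      using fun_subspaceD(2)[OF S st(1,2)] by (intro bexI[of _ "\<lambda>x. s x + t x"]) auto
  qed
next
  fix c f assume f: "f \<in> uniform_closure_on X S"
  show "(\<lambda>x. c * f x) \<in> uniform_closure_on X S"
    unfolding uniform_closure_on_def
  proof (intro CollectI allI impI)
    fix \<epsilon> :: real assume e: "\<epsilon> > 0"
    then have "\<epsilon> / (\<bar>c\<bar> + 1) > 0" by simp
    then obtain s where s: "s \<in> S" "\<And>x. x \<in> X \<Longrightarrow> \<bar>f x - s x\<bar> \<le> \<epsilon> / (\<bar>c\<bar> + 1)"
      using f unfolding uniform_closure_on_def by blast
    have "\<bar>c * f x - c * s x\<bar> \<le> \<epsilon>" if "x \<in> X" for x
    proof -
      have "\<bar>c * f x - c * s x\<bar> = \<bar>c\<bar> * \<bar>f x - s x\<bar>" by (simp add: abs_mult flip: right_diff_distrib)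
      also have "\<dots> \<le> (\<bar>c\<bar> + 1) * (\<epsilon> / (\<bar>c\<bar> + 1))"
        using s(2)[OF that] by (intro mult_mono) auto
      finally show ?thesis by simp
    qed
    then show "\<exists>u\<in>S. \<forall>x\<in>X. \<bar>c * f x - u x\<bar> \<le> \<epsilon>"
      using fun_subspaceD(3)[OF S s(1)] by (intro bexI[of _ "\<lambda>x. c * s x"]) auto
  qed
qed

text \<open>A Riemann sum argument: on a piece of \<open>K\<close> of small diameter the parameter \<open>z\<close> of \<open>\<Phi>\<close> may be replaced by a fixed
  centre, uniformly in \<open>x\<close>. The pieces are cut out of \<open>K\<close> one ball of a finite cover at a time.\<close>
lemma integral_in_uniform_closure_on:
  fixes \<Phi> :: "'b::metric_space \<Rightarrow> 'a::euclidean_space \<Rightarrow> real"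
  assumes S: "fun_subspace S" and X: "compact X" and K: "compact K"
    and \<Phi>: "continuous_on (X \<times> K) (\<lambda>p. \<Phi> (fst p) (snd p))"
    and mem: "\<And>z. z \<in> K \<Longrightarrow> (\<lambda>x. \<Phi> x z) \<in> uniform_closure_on X S"
    and w: "continuous_on K w" "\<And>z. z \<notin> K \<Longrightarrow> w z = 0"
  shows "(\<lambda>x. \<integral>z. \<Phi> x z * w z \<partial>lborel) \<in> uniform_closure_on X S"
proof (rule uniform_closure_on_closed)
  fix \<epsilon> :: real assume e: "\<epsilon> > 0"
  let ?T = "uniform_closure_on X S"
  have T: "fun_subspace ?T" by (rule fun_subspace_uniform_closure_on[OF S])
  have iw: "integrable lborel w" by (rule integrable_compact_support[OF w(1) K w(2)])
  have i\<Phi>: "integrable lborel (\<lambda>z. \<Phi> x z * w z)" if "x \<in> X" for x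
  proof (rule integrable_compact_support[OF _ K])
    have "continuous_on K (\<lambda>z. \<Phi> (fst (x, z)) (snd (x, z)))"
      by (rule continuous_on_compose2[OF \<Phi>]) (use that in \<open>auto intro!: continuous_intros\<close>)
    then show "continuous_on K (\<lambda>z. \<Phi> x z * w z)" using w(1) by (auto intro!: continuous_intros)
  qed (simp add: w)
  have iA: "integrable lborel (\<lambda>z. indicator A z * f z)"
    if "A \<in> sets borel" "integrable lborel f" for A and f :: "'a \<Rightarrow> real"
    using integrable_mult_indicator[of A lborel f] that by simp
  define B where "B = (\<integral>z. \<bar>w z\<bar> \<partial>lborel)"
  have B: "B \<ge> 0" by (simp add: B_def)
  define \<eta> where "\<eta> = \<epsilon> / (B + 1)"
  have \<eta>: "\<eta> > 0" using e B by (simp add: \<eta>_def)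
  obtain \<delta> where \<delta>: "\<delta> > 0"
    "\<And>p q. p \<in> X \<times> K \<Longrightarrow> q \<in> X \<times> K \<Longrightarrow> dist q p < \<delta> \<Longrightarrow>
       dist (\<Phi> (fst q) (snd q)) (\<Phi> (fst p) (snd p)) < \<eta>"
    using compact_uniformly_continuous[OF \<Phi> compact_Times[OF X K]] \<eta>
    unfolding uniformly_continuous_on_def by metis
  have osc: "\<bar>\<Phi> x z - \<Phi> x z'\<bar> \<le> \<eta>" if "x \<in> X" "z \<in> K" "z' \<in> K" "dist z z' < \<delta>" for x z z'
    using \<delta>(2)[of "(x, z')" "(x, z)"] that by (simp add: dist_Pair_Pair dist_real_def less_imp_le)
  have step: "\<exists>f\<in>?T. \<forall>x\<in>X. \<bar>(\<integral>z. indicator A z * (\<Phi> x z * w z) \<partial>lborel) - f x\<bar>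
          \<le> \<eta> * (\<integral>z. indicator A z * \<bar>w z\<bar> \<partial>lborel)"
    if "finite Z" "Z \<subseteq> K" "A \<subseteq> (\<Union>z\<in>Z. ball z \<delta>)" "A \<subseteq> K" "A \<in> sets borel" for Z A
    using that
  proof (induction Z arbitrary: A)
    case empty
    then show ?case using fun_subspaceD(1)[OF T] by (intro bexI[of _ "\<lambda>x. 0"]) auto
  next
    case (insert c Z)
    define A1 where "A1 = A \<inter> ball c \<delta>"
    define A2 where "A2 = A - ball c \<delta>"
    have m: "A1 \<in> sets borel" "A2 \<in> sets borel" using insert.prems by (auto simp: A1_def A2_def)
    have split: "indicator A z = indicator A1 z + (indicator A2 z :: real)" for z
      by (auto simp: A1_def A2_def indicator_def)
    have "A2 \<subseteq> (\<Union>z\<in>Z. ball z \<delta>)" "A2 \<subseteq> K" using insert.prems by (auto simp: A2_def)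
    then obtain f where f: "f \<in> ?T" "\<And>x. x \<in> X \<Longrightarrow>
       \<bar>(\<integral>z. indicator A2 z * (\<Phi> x z * w z) \<partial>lborel) - f x\<bar> \<le> \<eta> * (\<integral>z. indicator A2 z * \<bar>w z\<bar> \<partial>lborel)"
      using insert.IH[of A2] insert.prems m by blast
    define v where "v = (\<integral>z. indicator A1 z * w z \<partial>lborel)"
    have c: "c \<in> K" using insert.prems by auto
    have f1: "\<bar>(\<integral>z. indicator A1 z * (\<Phi> x z * w z) \<partial>lborel) - v * \<Phi> x c\<bar>
          \<le> \<eta> * (\<integral>z. indicator A1 z * \<bar>w z\<bar> \<partial>lborel)" if x: "x \<in> X" for x
    proof -
      have eq: "(\<integral>z. indicator A1 z * (\<Phi> x z * w z) \<partial>lborel) - v * \<Phi> x c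
         = (\<integral>z. indicator A1 z * (\<Phi> x z * w z) - indicator A1 z * w z * \<Phi> x c \<partial>lborel)"
        unfolding v_def using iA[OF m(1) iw] iA[OF m(1) i\<Phi>[OF x]] by simp
      have "norm (\<integral>z. indicator A1 z * (\<Phi> x z * w z) - indicator A1 z * w z * \<Phi> x c \<partial>lborel)
          \<le> (\<integral>z. \<eta> * (indicator A1 z * \<bar>w z\<bar>) \<partial>lborel)"
      proof (rule Bochner_Integration.integral_norm_bound_integral)
        show "integrable lborel (\<lambda>z. indicator A1 z * (\<Phi> x z * w z) - indicator A1 z * w z * \<Phi> x c)"
          using iA[OF m(1) iw] iA[OF m(1) i\<Phi>[OF x]] by simp
        show "integrable lborel (\<lambda>z. \<eta> * (indicator A1 z * \<bar>w z\<bar>))"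
          using iA[OF m(1)] iw by simp
        fix z
        show "norm (indicator A1 z * (\<Phi> x z * w z) - indicator A1 z * w z * \<Phi> x c) \<le> \<eta> * (indicator A1 z * \<bar>w z\<bar>)"
        proof (cases "z \<in> A1")
          case True
          then have "\<bar>\<Phi> x z - \<Phi> x c\<bar> \<le> \<eta>"
            using insert.prems c x by (intro osc) (auto simp: A1_def dist_commute)
          then have "\<bar>\<Phi> x z - \<Phi> x c\<bar> * \<bar>w z\<bar> \<le> \<eta> * \<bar>w z\<bar>" by (rule mult_right_mono) simp
          moreover have "\<Phi> x z * w z - w z * \<Phi> x c = (\<Phi> x z - \<Phi> x c) * w z" by (simp add: algebra_simps)
          ultimately show ?thesis using True by (simp add: abs_mult)
        qed simp
      qed
      then show ?thesis unfolding eq by simp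
    qed
    have "(\<lambda>x. v * \<Phi> x c + f x) \<in> ?T"
      using fun_subspaceD(2)[OF T fun_subspaceD(3)[OF T mem[OF c]] f(1)] .
    moreover have "\<bar>(\<integral>z. indicator A z * (\<Phi> x z * w z) \<partial>lborel) - (v * \<Phi> x c + f x)\<bar>
          \<le> \<eta> * (\<integral>z. indicator A z * \<bar>w z\<bar> \<partial>lborel)" if x: "x \<in> X" for x
    proof -
      have "(\<integral>z. indicator A z * g z \<partial>lborel)
          = (\<integral>z. indicator A1 z * g z \<partial>lborel) + (\<integral>z. indicator A2 z * g z \<partial>lborel)"
        if "integrable lborel g" for g :: "'a \<Rightarrow> real"
        using iA[OF m(1) that] iA[OF m(2) that] by (simp add: split distrib_right)
      note split_integral = this[OF i\<Phi>[OF x]] this[OF integrable_abs[OF iw]]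
      have tri: "\<bar>p + q - (r + t)\<bar> \<le> c * (m1 + m2)"
        if "\<bar>p - r\<bar> \<le> c * m1" "\<bar>q - t\<bar> \<le> c * m2" for p q r t c m1 m2 :: real
        using that unfolding distrib_left by linarith
      show ?thesis
        by (simp only: split_integral) (rule tri[OF f1[OF x] f(2)[OF x]])
    qed
    ultimately show ?case by (intro bexI[of _ "\<lambda>x. v * \<Phi> x c + f x"] ballI)
  qed
  obtain Z where "Z \<subseteq> K" "finite Z" "K \<subseteq> (\<Union>z\<in>Z. ball z \<delta>)"
    using compactE_image[OF K, of K "\<lambda>z. ball z \<delta>"] \<delta>(1) by (metis UN_I centre_in_ball open_ball subsetI)
  then obtain f where f: "f \<in> ?T" "\<And>x. x \<in> X \<Longrightarrow>
       \<bar>(\<integral>z. indicator K z * (\<Phi> x z * w z) \<partial>lborel) - f x\<bar> \<le> \<eta> * (\<integral>z. indicator K z * \<bar>w z\<bar> \<partial>lborel)"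
    using step[of Z K] borel_compact[OF K] by blast
  have "(\<lambda>z. indicator K z * (\<Phi> x z * w z)) = (\<lambda>z. \<Phi> x z * w z)"
    "(\<lambda>z. indicator K z * \<bar>w z\<bar>) = (\<lambda>z. \<bar>w z\<bar>)" for x
    using w(2) by (auto simp: fun_eq_iff indicator_def)
  note f = f[unfolded this, folded B_def]
  have "\<eta> * B \<le> \<eta> * (B + 1)" using \<eta> by simp
  also have "\<dots> = \<epsilon>" using B by (simp add: \<eta>_def)
  finally show "\<exists>g\<in>?T. \<forall>x\<in>X. \<bar>(\<integral>z. \<Phi> x z * w z \<partial>lborel) - g x\<bar> \<le> \<epsilon>"
    using f order_trans by (intro bexI[of _ f] ballI) blast+
qed

section \<open>Bump functions\<close>

text \<open>At \<open>0\<close>, where the two branches meet, the function is \<open>u\<close> times the continuous function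
  \<open>max(0, u)\<close> to the power \<open>m - 1\<close>, which vanishes there.\<close>
lemma has_derivative_pos_part_power:
  assumes "m \<ge> 2"
  shows "((\<lambda>u. max 0 u ^ m) has_real_derivative real m * max 0 u ^ (m - 1)) (at u)"
proof -
  consider "u > 0" | "u < 0" | "u = 0" by linarith
  then show ?thesis
  proof cases
    case 1
    have "((\<lambda>u. u ^ m) has_real_derivative real m * max 0 u ^ (m - 1)) (at u)"
      using 1 by (auto intro!: derivative_eq_intros)
    then show ?thesis
      by (rule has_field_derivative_transform_within_open[of _ _ _ "{0<..}"]) (use 1 in auto)
  next
    case 2
    have "((\<lambda>u. 0) has_real_derivative real m * max 0 u ^ (m - 1)) (at u)"
      using 2 assms by (auto simp: zero_power)
    then show ?thesis
      by (rule has_field_derivative_transform_within_open[of _ _ _ "{..<0}"])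
         (use 2 assms in \<open>auto simp: zero_power\<close>)
  next
    case 3
    have "max 0 z ^ m = max 0 z ^ (m - 1) * z" for z :: real
      using assms by (cases "z \<ge> 0") (auto simp: power_eq_if max_def)
    moreover have "isCont (\<lambda>z::real. max 0 z ^ (m - 1)) 0"
      by (intro continuous_intros)
    ultimately show ?thesis
      using 3 assms unfolding CARAT_DERIV
      by (intro exI[of _ "\<lambda>z. max 0 z ^ (m - 1)"]) (auto simp: zero_power)
  qed
qed

definition bump_jet :: "real \<Rightarrow> nat \<Rightarrow> nat \<Rightarrow> real \<Rightarrow> real" where
  "bump_jet r N n t = (-1) ^ n * (\<Prod>i<n. real (N - i)) * max 0 (r\<^sup>2 - t) ^ (N - n)"

lemma is_jet_bump_jet: "is_jet (N - 1) (bump_jet r N)"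
  unfolding is_jet_def
proof (intro allI impI)
  fix n and t :: real assume n: "n < N - 1"
  have d: "((\<lambda>t. r\<^sup>2 - t) has_real_derivative -1) (at t)"
    by (auto intro!: derivative_eq_intros)
  have "((\<lambda>u. max 0 u ^ (N - n)) has_real_derivative
      real (N - n) * max 0 (r\<^sup>2 - t) ^ (N - n - 1)) (at (r\<^sup>2 - t))"
    using n by (intro has_derivative_pos_part_power) simp
  from DERIV_cmult[OF DERIV_chain2[OF this d], of "(-1) ^ n * (\<Prod>i<n. real (N - i))"]
  have "((\<lambda>t. (-1) ^ n * (\<Prod>i<n. real (N - i)) * max 0 (r\<^sup>2 - t) ^ (N - n)) has_real_derivative
      bump_jet r N (Suc n) t) (at t)"
    by (simp add: bump_jet_def algebra_simps)
  then show "(bump_jet r N n has_real_derivative bump_jet r N (Suc n) t) (at t)"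
    unfolding bump_jet_def[of r N n, abs_def] .
qed

lemma bump_jet_0: "bump_jet r N 0 t = max 0 (r\<^sup>2 - t) ^ N"
  by (simp add: bump_jet_def)

lemma bump_jet_eq_0: "n < N \<Longrightarrow> t \<ge> r\<^sup>2 \<Longrightarrow> bump_jet r N n t = 0"
  by (simp add: bump_jet_def)

lemma jet_laplacian_power_eq_0:
  assumes "\<And>n. n \<le> m + 2 * k \<Longrightarrow> F n t = 0" "n \<le> m"
  shows "(jet_laplacian d ^^ k) F n t = 0"
  using assms
proof (induction k arbitrary: m n)
  case (Suc k)
  have "(jet_laplacian d ^^ k) F j t = 0" if "j \<le> m + 2" for j
    using Suc.IH[of "m + 2" j] Suc.prems(1) that by simp
  then show ?case using Suc.prems(2)
    by (simp add: jet_laplacian_def[of d "(jet_laplacian d ^^ k) F"])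
qed simp

lemma uniformly_continuous_near_compact:
  fixes h :: "'a::euclidean_space \<Rightarrow> real"
  assumes h: "continuous_on UNIV h" and X: "compact X" and "\<eta> > 0"
  obtains \<rho> where "\<rho> > 0" "\<And>x z. x \<in> X \<Longrightarrow> dist x z \<le> \<rho> \<Longrightarrow> \<bar>h z - h x\<bar> \<le> \<eta>"
proof -
  obtain B where B: "\<And>x. x \<in> X \<Longrightarrow> norm x \<le> B"
    using compact_imp_bounded[OF X] unfolding bounded_iff by blast
  have "uniformly_continuous_on (cball 0 (B + 1)) h"
    by (rule compact_uniformly_continuous) (use h in \<open>auto intro: continuous_on_subset\<close>)
  then obtain \<rho> where \<rho>: "\<rho> > 0"
    "\<And>x z. x \<in> cball 0 (B + 1) \<Longrightarrow> z \<in> cball 0 (B + 1) \<Longrightarrow> dist z x < \<rho> \<Longrightarrow> dist (h z) (h x) < \<eta>"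
    using \<open>\<eta> > 0\<close> unfolding uniformly_continuous_on_def by metis
  show ?thesis
  proof (rule that[of "min (\<rho> / 2) 1"])
    fix x z assume xz: "x \<in> X" "dist x z \<le> min (\<rho> / 2) 1"
    have "norm z \<le> norm x + dist x z"
      by (metis dist_norm norm_minus_commute norm_triangle_sub)
    then have "dist (h z) (h x) < \<eta>"
      using xz B[of x] \<rho>(1) by (intro \<rho>(2)) (auto simp: dist_commute)
    then show "\<bar>h z - h x\<bar> \<le> \<eta>" by (simp add: dist_real_def)
  qed (use \<rho>(1) in auto)
qed

section \<open>The multiquadric kernel\<close>

definition multiquadric_kernel :: "nat \<Rightarrow> real \<Rightarrow> 'a::euclidean_space \<Rightarrow> real" where
  "multiquadric_kernel k e y = e ^ k * ((norm y)\<^sup>2 + e) powr (- real DIM('a) / 2 - real k)"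

lemma multiquadric_kernel_nonneg: "e > 0 \<Longrightarrow> multiquadric_kernel k e y \<ge> 0"
  by (simp add: multiquadric_kernel_def)

lemma continuous_multiquadric_kernel:
  assumes "e > 0"
  shows "continuous_on UNIV (multiquadric_kernel k e :: 'a::euclidean_space \<Rightarrow> real)"
proof -
  have "(norm y)\<^sup>2 + e \<noteq> 0" for y :: 'a
    using assms by (smt (verit) zero_le_power2)
  then show ?thesis
    unfolding multiquadric_kernel_def[abs_def] by (intro continuous_intros) auto
qed

lemma multiquadric_kernel_tail:
  assumes "e > 0" "\<rho> > 0" "\<rho> < norm (y::'a::euclidean_space)"
  shows "multiquadric_kernel k e y \<le> e ^ k * (\<rho>\<^sup>2) powr (- real DIM('a) / 2 - real k)"
proof -
  have "\<rho>\<^sup>2 \<le> (norm y)\<^sup>2 + e"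
    using assms by (intro add_increasing2 power_mono) auto
  then show ?thesis
    unfolding multiquadric_kernel_def using assms
    by (intro mult_left_mono powr_mono2') auto
qed

text \<open>On the ball of radius \<open>\<surd>e\<close> the kernel is at least \<open>e\<^sup>k\<close> times \<open>2 e\<close> to the power \<open>- d/2 - k\<close>, and the volume
  of that ball is proportional to \<open>e\<close> to the power \<open>d/2\<close>: all powers of \<open>e\<close> cancel.\<close>
lemma multiquadric_kernel_mass:
  assumes "0 < e" "e \<le> 1" "1 \<le> R"
  shows "2 powr (- real DIM('a) / 2 - real k) * unit_ball_vol (real DIM('a))
    \<le> (\<integral>y. indicator (cball 0 R) y * multiquadric_kernel k e (y::'a::euclidean_space) \<partial>lborel)"
proof -
  let ?p = "- real DIM('a) / 2 - real k"
  have "e ^ k * (2 * e) powr ?p * measure lborel (cball (0::'a) (sqrt e))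
    \<le> (\<integral>y. indicator (cball 0 R) y * multiquadric_kernel k e (y::'a) \<partial>lborel)"
  proof (rule kernel_mass_lower_bound)
    show "sqrt e \<le> R" using assms by (smt (verit) real_sqrt_le_1_iff)
    fix y :: 'a assume "norm y \<le> sqrt e"
    then have "(norm y)\<^sup>2 \<le> e" using assms by (metis norm_ge_zero power_mono real_sqrt_pow2 less_imp_le)
    moreover have "(norm y)\<^sup>2 + e > 0" using assms by (smt (verit) zero_le_power2)
    ultimately show "e ^ k * (2 * e) powr ?p \<le> multiquadric_kernel k e y"
      unfolding multiquadric_kernel_def using assms
      by (intro mult_left_mono powr_mono2') auto
  qed (use assms in \<open>auto intro: continuous_multiquadric_kernel multiquadric_kernel_nonneg\<close>)
  also have "measure lborel (cball (0::'a) (sqrt e)) = unit_ball_vol (real DIM('a)) * e powr (real DIM('a) / 2)"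
  proof -
    have "sqrt e ^ DIM('a) = e powr (real DIM('a) / 2)"
      using assms by (simp add: powr_half_sqrt[symmetric] powr_powr flip: powr_realpow)
    then show ?thesis using assms by (simp add: content_cball)
  qed
  also have "e ^ k * (2 * e) powr ?p * (unit_ball_vol (real DIM('a)) * e powr (real DIM('a) / 2))
     = 2 powr ?p * unit_ball_vol (real DIM('a)) * (e powr real k * e powr ?p * e powr (real DIM('a) / 2))"
    using assms by (simp add: powr_mult powr_realpow)
  also have "e powr real k * e powr ?p * e powr (real DIM('a) / 2) = 1"
    using assms by (simp flip: powr_add)
  finally show ?thesis by simp
qed

section \<open>Density\<close>

text \<open>Convolving \<open>h\<close> with a bump of radius \<open>r \<le> \<delta>\<close> and dividing by the mass of the bump changes \<open>h\<close> little, and the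
  convolution is an integral over \<open>K\<close> of bumps centred in \<open>K\<close>.\<close>
lemma mollification_in_uniform_closure_on:
  fixes h :: "'a::euclidean_space \<Rightarrow> real"
  assumes S: "fun_subspace S" and X: "compact X" and K: "compact K"
    and h: "continuous_on UNIV h" "\<And>z. z \<notin> K \<Longrightarrow> h z = 0"
    and "N > 0" and "\<delta> > 0" and bump: "\<And>c r. c \<in> K \<Longrightarrow> 0 < r \<Longrightarrow> r \<le> \<delta> \<Longrightarrow>
      (\<lambda>x. max 0 (r\<^sup>2 - (norm (x - c))\<^sup>2) ^ N) \<in> uniform_closure_on X S"
  shows "h \<in> uniform_closure_on X S"
proof (rule uniform_closure_on_closed)
  fix \<eta> :: real assume "\<eta> > 0"
  let ?T = "uniform_closure_on X S"
  have T: "fun_subspace ?T" by (rule fun_subspace_uniform_closure_on[OF S])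
  obtain \<rho> where \<rho>: "\<rho> > 0" "\<And>x z. x \<in> X \<Longrightarrow> dist x z \<le> \<rho> \<Longrightarrow> \<bar>h z - h x\<bar> \<le> \<eta>"
    using uniformly_continuous_near_compact[OF h(1) X \<open>\<eta> > 0\<close>] by blast
  define r where "r = min \<rho> \<delta>"
  have r: "r > 0" "r \<le> \<rho>" "r \<le> \<delta>" using \<rho>(1) \<open>\<delta> > 0\<close> by (auto simp: r_def)
  define \<kappa> :: "'a \<Rightarrow> real" where "\<kappa> y = max 0 (r\<^sup>2 - (norm y)\<^sup>2) ^ N" for y
  have c\<kappa>: "continuous_on UNIV \<kappa>" unfolding \<kappa>_def[abs_def] by (intro continuous_intros)
  obtain B where B: "\<And>x. x \<in> X \<union> K \<Longrightarrow> norm x \<le> B"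
    using compact_imp_bounded[OF compact_Un[OF X K]] unfolding bounded_iff by blast
  obtain M where M: "\<And>z. \<bar>h z\<bar> \<le> M"
  proof -
    have "bounded (h ` K)"
      by (intro compact_imp_bounded compact_continuous_image K continuous_on_subset[OF h(1)]) auto
    then obtain M where "M > 0" "\<And>z. z \<in> K \<Longrightarrow> \<bar>h z\<bar> \<le> M"
      unfolding bounded_pos by (metis imageI real_norm_def)
    then have "\<bar>h z\<bar> \<le> M" for z using h(2)[of z] by (cases "z \<in> K") auto
    then show ?thesis by (rule that)
  qed
  define R where "R = max (2 * B) r"
  define m where "m = (\<integral>y. indicator (cball 0 R) y * \<kappa> y \<partial>lborel)"
  have "(r\<^sup>2 / 2) ^ N * measure lborel (cball (0::'a) (r / 2)) \<le> m"
    unfolding m_def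
  proof (rule kernel_mass_lower_bound[OF c\<kappa>])
    fix y :: 'a assume "norm y \<le> r / 2"
    then have "(norm y)\<^sup>2 \<le> (r / 2)\<^sup>2" by (intro power_mono) auto
    then have "(norm y)\<^sup>2 \<le> r\<^sup>2 / 4" by (simp add: power_divide)
    then have "r\<^sup>2 / 2 \<le> r\<^sup>2 - (norm y)\<^sup>2"
      using zero_le_power2[of "norm y"] by linarith
    then show "(r\<^sup>2 / 2) ^ N \<le> \<kappa> y" unfolding \<kappa>_def by (intro power_mono max.coboundedI2) auto
  qed (use r in \<open>auto simp: \<kappa>_def R_def\<close>)
  moreover have "(r\<^sup>2 / 2) ^ N * measure lborel (cball (0::'a) (r / 2)) > 0"
    using r by simp
  ultimately have m: "m > 0" by linarith
  have "(\<lambda>x. \<integral>z. \<kappa> (x - z) * h z \<partial>lborel) \<in> ?T"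
  proof (rule integral_in_uniform_closure_on[OF S X K])
    show "continuous_on (X \<times> K) (\<lambda>p. \<kappa> (fst p - snd p))"
      unfolding \<kappa>_def by (intro continuous_intros)
    show "(\<lambda>x. \<kappa> (x - z)) \<in> ?T" if "z \<in> K" for z
      using bump[OF that r(1,3)] by (simp add: \<kappa>_def)
  qed (use h in \<open>auto intro: continuous_on_subset\<close>)
  then have "(\<lambda>x. 1 / m * (\<integral>z. \<kappa> (x - z) * h z \<partial>lborel)) \<in> ?T"
    by (rule fun_subspaceD(3)[OF T])
  moreover have "\<bar>h x - 1 / m * (\<integral>z. \<kappa> (x - z) * h z \<partial>lborel)\<bar> \<le> \<eta>" if x: "x \<in> X" for x
  proof -
    have "\<bar>(\<integral>z. \<kappa> (z - x) * h z \<partial>lborel) - m * h x\<bar>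
        \<le> \<eta> * m + 2 * M * 0 * measure lborel (cball (0::'a) R)"
      unfolding m_def
    proof (rule kernel_average_error[OF c\<kappa> h(1)])
      show "\<kappa> y \<le> 0" if "r < norm y" for y
      proof -
        have "r\<^sup>2 \<le> (norm y)\<^sup>2" using that r by (intro power_mono) auto
        then show ?thesis using \<open>N > 0\<close> by (simp add: \<kappa>_def zero_power)
      qed
      show "h z = 0" if "R < dist x z" for z
      proof (rule h(2), rule notI)
        assume "z \<in> K"
        then have "dist x z \<le> 2 * B"
          using B[of x] B[of z] x norm_triangle_ineq4[of x z] by (simp add: dist_norm)
        then show False using that by (simp add: R_def)
      qed
    qed (use M \<rho>(2)[OF x] r \<open>\<eta> > 0\<close> in \<open>auto simp: \<kappa>_def\<close>)
    moreover have "\<kappa> (z - x) = \<kappa> (x - z)" for z by (simp add: \<kappa>_def norm_minus_commute)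
    ultimately have "\<bar>(\<integral>z. \<kappa> (x - z) * h z \<partial>lborel) - m * h x\<bar> \<le> \<eta> * m" by simp
    moreover have "h x - 1 / m * (\<integral>z. \<kappa> (x - z) * h z \<partial>lborel)
        = - ((\<integral>z. \<kappa> (x - z) * h z \<partial>lborel) - m * h x) / m"
      using m by (simp add: field_simps)
    ultimately show ?thesis using m by (simp add: abs_divide divide_le_eq)
  qed
  ultimately show "\<exists>g\<in>?T. \<forall>x\<in>X. \<bar>h x - g x\<bar> \<le> \<eta>" by (intro bexI) auto
qed

lemma fun_subspace_spline_translates_span: "fun_subspace (spline_translates_span k \<Omega>)"
proof -
  interpret vector_space "\<lambda>(c::real) (f::real ^ 'n \<Rightarrow> real) x. c * f x" by (rule fun_vector_space)
  show ?thesis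
    unfolding spline_translates_span_def by (rule subspace_span)
qed

lemma spline_translate_in_span:
  fixes \<Omega> :: "(real ^ 'n) set"
  assumes "z \<in> \<Omega>"
  shows "(\<lambda>x. polyharmonic_spline CARD('n) k (norm (x - z))) \<in> spline_translates_span k \<Omega>"
proof -
  interpret vector_space "\<lambda>(c::real) (f::real ^ 'n \<Rightarrow> real) x. c * f x" by (rule fun_vector_space)
  show ?thesis
    unfolding spline_translates_span_def using assms by (intro span_base) auto
qed

text \<open>For the bump \<open>w\<close>, the function \<open>u = \<integral> \<phi>(|x - z|) (\<Delta>\<^sup>k w)(z) dz\<close> lies in the closure, and so do its multiples. Replacing \<open>\<phi>\<close>
  by its shifted version changes \<open>u\<close> little and, by Green's identity, gives \<open>C\<close> times an average of \<open>w\<close>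
  against the multiquadric kernel of mass \<open>m\<close>; hence \<open>u / (C m)\<close> is close to \<open>w\<close> for small \<open>e\<close>. The exponent \<open>2k + 2\<close> makes
  the bump smooth enough for \<open>k\<close> applications of Green's identity.\<close>
lemma bump_in_spline_closure:
  fixes \<Omega> :: "(real ^ 'n) set"
  assumes k: "2 * k > CARD('n)" and \<Omega>: "compact \<Omega>" and ball: "cball c r \<subseteq> \<Omega>" and r: "r > 0"
  shows "(\<lambda>x. max 0 (r\<^sup>2 - (norm (x - c))\<^sup>2) ^ (2 * k + 2))
      \<in> uniform_closure_on \<Omega> (spline_translates_span k \<Omega>)"
proof (rule uniform_closure_on_closed)
  fix \<epsilon> :: real assume \<epsilon>: "\<epsilon> > 0"
  let ?T = "uniform_closure_on \<Omega> (spline_translates_span k \<Omega>)"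
  let ?L = "jet_laplacian (real CARD('n))"
  define d where "d = CARD('n)"
  define p where "p = - real d / 2 - real k"
  define s where "s = real k - real d / 2"
  have S: "fun_subspace (spline_translates_span k \<Omega>)" by (rule fun_subspace_spline_translates_span)
  have T: "fun_subspace ?T" by (rule fun_subspace_uniform_closure_on[OF S])
  have d0: "d > 0" by (simp add: d_def)
  have s0: "s > 0" using k by (simp add: s_def d_def)
  obtain a b where ab: "spline_coeffs s a b" "b k = 0" "a k \<noteq> 0"
    and spline: "\<And>t. t \<ge> 0 \<Longrightarrow> polyharmonic_spline d k t = (t\<^sup>2) powr s * (a 0 + b 0 * ln (t\<^sup>2))"
    using spline_coeffs_exist[of d k] k d0 unfolding s_def d_def by blast
  define f where "f t = t powr s * (a 0 + b 0 * ln t)" for t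
  have cf: "continuous_on {0..} f"
    unfolding f_def[abs_def] by (rule continuous_spline_profile[OF s0])
  define W where "W = bump_jet r (2 * k + 2)"
  have jW: "is_jet (2 * k + 1) W" using is_jet_bump_jet[of "2 * k + 2" r] by (simp add: W_def)
  have W0: "W n t = 0" if "n \<le> 2 * k" "t \<ge> r\<^sup>2" for n t
    using that by (simp add: W_def bump_jet_eq_0)
  define w where "w z = max 0 (r\<^sup>2 - (norm (z - c))\<^sup>2) ^ (2 * k + 2)" for z
  have wW: "w z = W 0 ((norm (z - c))\<^sup>2)" for z by (simp add: w_def W_def bump_jet_0)
  have cw: "continuous_on UNIV w" unfolding w_def[abs_def] by (intro continuous_intros)
  have out: "r\<^sup>2 \<le> (norm (z - c))\<^sup>2" if "z \<notin> cball c r" for z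
    using that r by (intro power_mono) (auto simp: dist_norm norm_minus_commute)
  have w0: "w z = 0" if "z \<notin> cball c r" for z
    using out[OF that] by (simp add: wW W0)
  have wM: "\<bar>w z\<bar> \<le> (r\<^sup>2) ^ (2 * k + 2)" for z
    unfolding w_def power_abs by (intro power_mono) auto
  define q where "q z = (?L ^^ k) W 0 ((norm (z - c))\<^sup>2)" for z
  have "is_jet 1 ((?L ^^ k) W)"
    by (rule is_jet_laplacian_power) (use jW in \<open>simp add: add.commute\<close>)
  then have cq: "continuous_on UNIV q"
    unfolding q_def[abs_def] by (intro continuous_radial is_jet_continuous[of 1]) auto
  have q0: "q z = 0" if "z \<notin> cball c r" for z
    unfolding q_def using out[OF that] W0 by (intro jet_laplacian_power_eq_0[of 0]) auto
  have iq: "integrable lborel q"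
    using continuous_on_subset[OF cq] q0 by (intro integrable_compact_support[of "cball c r"]) auto
  define u where "u x = (\<integral>z. f ((norm (z - x))\<^sup>2) * q z \<partial>lborel)" for x
  have uT: "u \<in> ?T"
    unfolding u_def[abs_def]
  proof (rule integral_in_uniform_closure_on[OF S \<Omega>])
    show "continuous_on (\<Omega> \<times> cball c r) (\<lambda>p. f ((norm (snd p - fst p))\<^sup>2))"
      by (rule continuous_on_compose2[OF cf]) (auto intro!: continuous_intros)
    show "(\<lambda>x. f ((norm (z - x))\<^sup>2)) \<in> ?T" if "z \<in> cball c r" for z
    proof -
      have "(\<lambda>x. f ((norm (z - x))\<^sup>2)) = (\<lambda>x. polyharmonic_spline CARD('n) k (norm (x - z)))"
        using spline by (simp add: f_def d_def norm_minus_commute fun_eq_iff)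
      moreover have "z \<in> \<Omega>" using that ball by blast
      ultimately show ?thesis
        using spline_translate_in_span[of z \<Omega> k]
          subsetD[OF uniform_closure_on_superset[of "spline_translates_span k \<Omega>" \<Omega>]] by simp
    qed
  qed (use q0 in \<open>auto intro: continuous_on_subset[OF cq]\<close>)
  define C where "C = a k * 4 ^ k * pochhammer (real d / 2) k"
  have C: "C \<noteq> 0"
    using ab(3) d0 pochhammer_pos[of "real d / 2" k] by (simp add: C_def)
  have green: "(\<integral>z. f ((norm (z - x))\<^sup>2 + e) * q z \<partial>lborel)
       = C * (\<integral>z. multiquadric_kernel k e (z - x) * w z \<partial>lborel)" if e: "e > 0" for e x
  proof -
    have "(\<integral>z. f ((norm (z - x))\<^sup>2 + e) * q z \<partial>lborel)
       = (\<integral>z. spline_jet s a b e 0 ((norm (z - x))\<^sup>2) * q z \<partial>lborel)"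
      by (simp add: f_def spline_jet_def)
    also have "\<dots> = (\<integral>z. (?L ^^ k) (spline_jet s a b e) 0 ((norm (z - x))\<^sup>2) * w z \<partial>lborel)"
      using integral_radial_laplacian_power[OF is_jet_spline_jet[OF ab(1) e] jW W0 r, of x c]
      by (simp add: q_def wW)
    also have "\<dots> = (\<integral>z. C * (multiquadric_kernel k e (z - x) * w z) \<partial>lborel)"
    proof (intro Bochner_Integration.integral_cong refl)
      fix z
      have "(norm (z - x))\<^sup>2 + e > 0" using e by (smt (verit) zero_le_power2)
      then have "(?L ^^ k) (spline_jet s a b e) 0 ((norm (z - x))\<^sup>2) = C * multiquadric_kernel k e (z - x)"
        using laplacian_power_spline_jet[of k d a b "(norm (z - x))\<^sup>2" e] ab(1,2)
        by (simp add: C_def s_def d_def multiquadric_kernel_def)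
      then show "(?L ^^ k) (spline_jet s a b e) 0 ((norm (z - x))\<^sup>2) * w z
          = C * (multiquadric_kernel k e (z - x) * w z)" by simp
    qed
    finally show ?thesis by simp
  qed
  obtain B where B: "\<And>x. x \<in> \<Omega> \<Longrightarrow> norm x \<le> B"
    using compact_imp_bounded[OF \<Omega>] unfolding bounded_iff by blast
  define R where "R = max (2 * B) 1"
  have R: "R \<ge> 1" by (simp add: R_def)
  have dR: "dist x z \<le> R" if "x \<in> \<Omega>" "z \<in> cball c r" for x z
  proof -
    have "z \<in> \<Omega>" using that ball by blast
    then have "dist x z \<le> 2 * B"
      using B[of x] B[of z] that(1) norm_triangle_ineq4[of x z] by (simp add: dist_norm)
    then show ?thesis by (simp add: R_def)
  qed
  obtain \<rho> where \<rho>: "\<rho> > 0" "\<And>x z. x \<in> \<Omega> \<Longrightarrow> dist x z \<le> \<rho> \<Longrightarrow> \<bar>w z - w x\<bar> \<le> \<epsilon> / 3"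
    using uniformly_continuous_near_compact[OF cw \<Omega>, of "\<epsilon> / 3"] \<epsilon> by auto
  define \<mu> where "\<mu> = 2 powr p * unit_ball_vol (real d)"
  have \<mu>: "\<mu> > 0" by (simp add: \<mu>_def)
  define Q where "Q = (\<integral>z. \<bar>q z\<bar> \<partial>lborel)"
  have Q: "Q \<ge> 0" by (simp add: Q_def)
  \<comment> \<open>The three errors, each at most \<open>\<epsilon> / 3\<close>: the oscillation of \<open>w\<close> near \<open>x\<close>, the tail \<open>e\<^sup>k A\<close> of the kernel,
    and the change \<open>\<omega> Q\<close> of \<open>u\<close> caused by the shift.\<close>
  define A where "A = 2 * (r\<^sup>2) ^ (2 * k + 2) * (\<rho>\<^sup>2) powr p * measure lborel (cball (0 :: real ^ 'n) R)"
  have A: "A \<ge> 0" by (simp add: A_def)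
  define \<omega> where "\<omega> = \<epsilon> * \<bar>C\<bar> * \<mu> / (3 * (Q + 1))"
  have \<omega>: "\<omega> > 0" using \<epsilon> C \<mu> Q by (simp add: \<omega>_def)
  have "uniformly_continuous_on {0..R\<^sup>2 + 1} f"
    by (rule compact_uniformly_continuous) (auto intro: continuous_on_subset[OF cf])
  then obtain e1 where e1: "e1 > 0"
    "\<And>s t. s \<in> {0..R\<^sup>2 + 1} \<Longrightarrow> t \<in> {0..R\<^sup>2 + 1} \<Longrightarrow> dist t s < e1 \<Longrightarrow> dist (f t) (f s) < \<omega>"
    using \<omega> unfolding uniformly_continuous_on_def by metis
  define e where "e = min (min 1 (e1 / 2)) (\<epsilon> * \<mu> / (3 * (A + 1)))"
  have e: "0 < e" "e \<le> 1" "e < e1" "e \<le> \<epsilon> * \<mu> / (3 * (A + 1))"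
    using e1(1) \<epsilon> \<mu> A by (auto simp: e_def min_less_iff_disj)
  define m where "m = (\<integral>y. indicator (cball 0 R) y * multiquadric_kernel k e (y :: real ^ 'n) \<partial>lborel)"
  have m\<mu>: "m \<ge> \<mu>"
    using multiquadric_kernel_mass[OF e(1,2) R, where 'a = "real ^ 'n", of k]
    by (simp add: m_def \<mu>_def p_def d_def)
  then have m: "m > 0" using \<mu> by linarith
  have "(\<lambda>x. 1 / (C * m) * u x) \<in> ?T" by (rule fun_subspaceD(3)[OF T uT])
  moreover have "\<bar>w x - 1 / (C * m) * u x\<bar> \<le> \<epsilon>" if x: "x \<in> \<Omega>" for x
  proof -
    define I where "I = (\<integral>z. multiquadric_kernel k e (z - x) * w z \<partial>lborel)"
    have "\<bar>I - m * w x\<bar> \<le> \<epsilon> / 3 * m + 2 * (r\<^sup>2) ^ (2 * k + 2) * (e ^ k * (\<rho>\<^sup>2) powr p)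
         * measure lborel (cball (0 :: real ^ 'n) R)"
      unfolding I_def m_def
    proof (rule kernel_average_error)
      show "multiquadric_kernel k e y \<le> e ^ k * (\<rho>\<^sup>2) powr p" if "\<rho> < norm y" for y :: "real ^ 'n"
        using multiquadric_kernel_tail[OF e(1) \<rho>(1) that, of k] by (simp add: p_def d_def)
      show "w z = 0" if "R < dist x z" for z
        using dR[OF x, of z] that by (intro w0) auto
      show "\<bar>w z\<bar> \<le> (r\<^sup>2) ^ (2 * k + 2)" for z by (rule wM)
      show "\<bar>w z - w x\<bar> \<le> \<epsilon> / 3" if "dist x z \<le> \<rho>" for z using x that by (rule \<rho>(2))
    qed (use e \<epsilon> in \<open>auto intro: continuous_multiquadric_kernel multiquadric_kernel_nonneg cw\<close>)
    also have "\<dots> = \<epsilon> / 3 * m + e ^ k * A" by (simp add: A_def)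
    also have "e ^ k * A \<le> \<epsilon> / 3 * m"
    proof -
      have "e ^ k \<le> e" using e k by (cases k) (auto simp: mult_le_one power_le_one mult_left_le)
      then have "e ^ k * A \<le> \<epsilon> * \<mu> / (3 * (A + 1)) * A" using e(4) A by (intro mult_right_mono) auto
      also have "\<dots> = \<epsilon> / 3 * \<mu> * (A / (A + 1))" by simp
      also have "\<dots> \<le> \<epsilon> / 3 * \<mu> * 1" using A \<epsilon> \<mu> by (intro mult_left_mono) auto
      also have "\<dots> \<le> \<epsilon> / 3 * m" using m\<mu> \<epsilon> by simp
      finally show ?thesis .
    qed
    finally have avg: "\<bar>I - m * w x\<bar> \<le> 2 * \<epsilon> / 3 * m" by simp
    have cfe: "continuous_on UNIV (\<lambda>z. f ((norm (z - x))\<^sup>2 + e))" if "e \<ge> 0" for e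
      by (rule continuous_on_compose2[OF cf]) (use that in \<open>auto intro!: continuous_intros\<close>)
    have if1: "integrable lborel (\<lambda>z. f ((norm (z - x))\<^sup>2 + e) * q z)" if "e \<ge> 0" for e
    proof (rule integrable_compact_support[of "cball c r"])
      show "continuous_on (cball c r) (\<lambda>z. f ((norm (z - x))\<^sup>2 + e) * q z)"
        by (intro continuous_on_subset[OF continuous_on_mult[OF cfe[OF that] cq]]) simp
    qed (use q0 in auto)
    have eq: "C * I - u x
        = (\<integral>z. f ((norm (z - x))\<^sup>2 + e) * q z - f ((norm (z - x))\<^sup>2) * q z \<partial>lborel)"
      using if1[of e] if1[of 0] green[OF e(1), of x] e(1) by (simp add: I_def u_def)
    have "norm (\<integral>z. f ((norm (z - x))\<^sup>2 + e) * q z - f ((norm (z - x))\<^sup>2) * q z \<partial>lborel)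
        \<le> (\<integral>z. \<omega> * \<bar>q z\<bar> \<partial>lborel)"
    proof (rule Bochner_Integration.integral_norm_bound_integral)
      fix z
      show "norm (f ((norm (z - x))\<^sup>2 + e) * q z - f ((norm (z - x))\<^sup>2) * q z) \<le> \<omega> * \<bar>q z\<bar>"
      proof (cases "z \<in> cball c r")
        case True
        then have "norm (z - x) \<le> R" using dR[OF x, of z] by (simp add: dist_norm norm_minus_commute)
        then have "(norm (z - x))\<^sup>2 \<le> R\<^sup>2" by (intro power_mono) auto
        then have "dist (f ((norm (z - x))\<^sup>2 + e)) (f ((norm (z - x))\<^sup>2)) < \<omega>"
          using e by (intro e1(2)) (auto simp: dist_real_def)
        then have "\<bar>f ((norm (z - x))\<^sup>2 + e) - f ((norm (z - x))\<^sup>2)\<bar> * \<bar>q z\<bar> \<le> \<omega> * \<bar>q z\<bar>"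
          by (intro mult_right_mono) (auto simp: dist_real_def)
        then show ?thesis by (simp only: left_diff_distrib[symmetric] real_norm_def abs_mult)
      qed (simp add: q0)
    qed (use if1[of e] if1[of 0] e(1) iq in auto)
    then have "\<bar>C * I - u x\<bar> \<le> \<omega> * Q" by (simp add: eq Q_def)
    also have "\<omega> * Q = \<epsilon> / 3 * \<bar>C\<bar> * \<mu> * (Q / (Q + 1))" by (simp add: \<omega>_def)
    also have "\<dots> \<le> \<epsilon> / 3 * \<bar>C\<bar> * \<mu> * 1" using Q \<epsilon> \<mu> by (intro mult_left_mono) auto
    also have "\<dots> \<le> \<epsilon> / 3 * \<bar>C\<bar> * m" using m\<mu> \<epsilon> by (simp add: mult_left_mono)
    finally have "\<bar>C * I - u x\<bar> \<le> \<epsilon> / 3 * \<bar>C\<bar> * m" .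
    then have "\<bar>C * I - u x\<bar> / \<bar>C\<bar> \<le> \<epsilon> / 3 * m" using C by (simp add: divide_le_eq mult_ac)
    moreover have "\<bar>C * I - u x\<bar> / \<bar>C\<bar> = \<bar>I - u x / C\<bar>"
      using C by (simp flip: abs_divide add: diff_divide_distrib)
    ultimately have "\<bar>u x / C - m * w x\<bar> \<le> \<epsilon> * m" using avg by linarith
    moreover have "w x - 1 / (C * m) * u x = - (u x / C - m * w x) / m"
      using m C by (simp add: field_simps)
    ultimately show ?thesis using m by (simp add: abs_divide divide_le_eq)
  qed
  ultimately show "\<exists>g\<in>?T. \<forall>x\<in>\<Omega>. \<bar>max 0 (r\<^sup>2 - (norm (x - c))\<^sup>2) ^ (2 * k + 2) - g x\<bar> \<le> \<epsilon>"
    by (intro bexI[of _ "\<lambda>x. 1 / (C * m) * u x"] ballI) (auto simp: w_def)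
qed

lemma compact_support_in_spline_closure:
  fixes \<Omega> :: "(real ^ 'n) set"
  assumes k: "2 * k > CARD('n)" and \<Omega>: "compact \<Omega>"
    and K: "compact K" "K \<subseteq> interior \<Omega>"
    and h: "continuous_on UNIV h" "\<And>z. z \<notin> K \<Longrightarrow> h z = 0"
  shows "h \<in> uniform_closure_on \<Omega> (spline_translates_span k \<Omega>)"
proof -
  obtain \<delta> where \<delta>: "\<delta> > 0" "(\<Union>c\<in>K. cball c \<delta>) \<subseteq> interior \<Omega>"
    using compact_subset_open_imp_cball_epsilon_subset[OF K(1) open_interior K(2)] by blast
  show ?thesis
  proof (rule mollification_in_uniform_closure_on[OF fun_subspace_spline_translates_span \<Omega> K(1) h, where N = "2 * k + 2"])
    fix c r assume c: "c \<in> K" and r: "0 < r" "r \<le> \<delta>"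
    have "cball c r \<subseteq> cball c \<delta>" using r(2) by (rule subset_cball)
    then have "cball c r \<subseteq> \<Omega>" using \<delta>(2) c interior_subset[of \<Omega>] by blast
    then show "(\<lambda>x. max 0 (r\<^sup>2 - (norm (x - c))\<^sup>2) ^ (2 * k + 2))
        \<in> uniform_closure_on \<Omega> (spline_translates_span k \<Omega>)"
      by (rule bump_in_spline_closure[OF k \<Omega> _ r(1)])
  qed (use \<delta>(1) in auto)
qed

text \<open>Clipping the values of \<open>g\<close> to \<open>[-\<epsilon>, \<epsilon>]\<close> and subtracting the result leaves a function supported in the
  compact set where \<open>|g| \<ge> \<epsilon>\<close>. That set avoids the frontier, so it lies in the interior; and since \<open>g\<close> is zero on
  the frontier, extending by zero is continuous.\<close>
lemma vanishing_on_frontier_in_spline_closure: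
  fixes \<Omega> :: "(real ^ 'n) set"
  assumes k: "2 * k > CARD('n)" and \<Omega>: "compact \<Omega>"
    and g: "continuous_on \<Omega> g" "\<And>x. x \<in> frontier \<Omega> \<Longrightarrow> g x = 0"
  shows "g \<in> uniform_closure_on \<Omega> (spline_translates_span k \<Omega>)"
proof (rule uniform_closure_on_closed)
  fix \<epsilon> :: real assume \<epsilon>: "\<epsilon> > 0"
  define h where "h z = (if z \<in> \<Omega> then g z - max (- \<epsilon>) (min \<epsilon> (g z)) else 0)" for z
  define K where "K = {z \<in> \<Omega>. \<epsilon> \<le> \<bar>g z\<bar>}"
  have cl: "closed \<Omega>" using \<Omega> by (rule compact_imp_closed)
  have "closed K"
    unfolding K_def by (intro continuous_on_closed_Collect_le cl continuous_intros g(1))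
  then have K: "compact K"
    using \<Omega> compact_Int_closed[of \<Omega> K] by (simp add: K_def Int_absorb1 Collect_restrict)
  have KI: "K \<subseteq> interior \<Omega>"
    using g(2) \<epsilon> cl by (force simp: K_def frontier_def)
  have cont: "continuous_on (\<Omega> \<union> - interior \<Omega>) h"
    unfolding h_def
  proof (rule continuous_on_cases)
    show "continuous_on \<Omega> (\<lambda>z. g z - max (- \<epsilon>) (min \<epsilon> (g z)))"
      using g(1) by (intro continuous_intros)
    have "g z = 0" if "z \<in> \<Omega>" "z \<notin> interior \<Omega>" for z
      using that cl g(2) by (simp add: frontier_def)
    then show "\<forall>z. z \<in> \<Omega> \<and> z \<notin> \<Omega> \<or> z \<in> - interior \<Omega> \<and> z \<in> \<Omega> \<longrightarrow>
        g z - max (- \<epsilon>) (min \<epsilon> (g z)) = 0"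
      using \<epsilon> by auto
  qed (use cl in auto)
  have "continuous_on UNIV h"
  proof -
    have "\<Omega> \<union> - interior \<Omega> = UNIV" using interior_subset[of \<Omega>] by blast
    then show ?thesis using cont by simp
  qed
  moreover have "h z = 0" if "z \<notin> K" for z
    using that by (auto simp: h_def K_def)
  ultimately have "h \<in> uniform_closure_on \<Omega> (spline_translates_span k \<Omega>)"
    using compact_support_in_spline_closure[OF k \<Omega> K KI] by blast
  moreover have "\<bar>g x - h x\<bar> \<le> \<epsilon>" if "x \<in> \<Omega>" for x
    using that \<epsilon> by (simp add: h_def)
  ultimately show "\<exists>h\<in>uniform_closure_on \<Omega> (spline_translates_span k \<Omega>). \<forall>x\<in>\<Omega>. \<bar>g x - h x\<bar> \<le> \<epsilon>"
    by blast
qed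

lemma spline_translates_span_continuous:
  fixes \<Omega> :: "(real ^ 'n) set"
  assumes k: "2 * k > CARD('n)" and s: "s \<in> spline_translates_span k \<Omega>"
  shows "continuous_on UNIV s"
proof -
  interpret vector_space "\<lambda>(c::real) (f::real ^ 'n \<Rightarrow> real) x. c * f x" by (rule fun_vector_space)
  have "continuous_on UNIV (\<lambda>x. polyharmonic_spline CARD('n) k (norm (x - z)))" for z :: "real ^ 'n"
  proof -
    obtain a b where "spline_coeffs (real k - real CARD('n) / 2) a b" "b k = 0" "a k \<noteq> 0"
      and eq: "\<And>t. t \<ge> 0 \<Longrightarrow> polyharmonic_spline CARD('n) k t
        = (t\<^sup>2) powr (real k - real CARD('n) / 2) * (a 0 + b 0 * ln (t\<^sup>2))"
      using spline_coeffs_exist[OF k zero_less_card_finite] by blast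
    have "real k - real CARD('n) / 2 > 0" using k by simp
    from continuous_radial[OF continuous_spline_profile[OF this, of "a 0" "b 0"], of z]
    show ?thesis by (simp add: eq)
  qed
  moreover have "subspace {f :: real ^ 'n \<Rightarrow> real. continuous_on UNIV f}"
    by (intro fun_subspaceI) (auto intro: continuous_intros)
  ultimately show ?thesis
    using span_minimal[of "(\<lambda>z x. polyharmonic_spline CARD('n) k (norm (x - z))) ` \<Omega>"
        "{f. continuous_on UNIV f}"] s
    unfolding spline_translates_span_def by blast
qed

theorem mainTheorem4:
  fixes k :: nat and \<Omega> :: "(real ^ 'n) set" and g :: "real ^ 'n \<Rightarrow> real"
  assumes "real k > real CARD('n) / 2"
    and "compact \<Omega>"
    and "g \<in> mspace (C_space \<Omega>)"
    and "\<And>x. x \<in> frontier \<Omega> \<Longrightarrow> g x = 0"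
  shows "g \<in> mtopology_of (C_space \<Omega>) closure_of
               ((\<lambda>s. restrict s \<Omega>) ` spline_translates_span k \<Omega>)"
proof -
  interpret C: Metric_space "mspace (C_space \<Omega>)" "mdist (C_space \<Omega>)"
    by (rule Metric_space_mspace_mdist)
  have k: "2 * k > CARD('n)" using assms(1) by linarith
  have g: "continuous_on \<Omega> g" using assms(3) by simp
  have approx: "g \<in> uniform_closure_on \<Omega> (spline_translates_span k \<Omega>)"
    by (rule vanishing_on_frontier_in_spline_closure[OF k assms(2) g assms(4)])
  have "\<exists>s\<in>spline_translates_span k \<Omega>. restrict s \<Omega> \<in> C.mcball g r" if r: "r > 0" for r
  proof -
    obtain s where s: "s \<in> spline_translates_span k \<Omega>" "\<And>x. x \<in> \<Omega> \<Longrightarrow> \<bar>g x - s x\<bar> \<le> r"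
      using approx r unfolding uniform_closure_on_def by blast
    have "restrict s \<Omega> \<in> mspace (C_space \<Omega>)"
      unfolding restrict_in_C_space_iff[OF assms(2)]
      using spline_translates_span_continuous[OF k s(1)] by (rule continuous_on_subset) simp
    moreover have "mdist (C_space \<Omega>) g (restrict s \<Omega>) \<le> r"
      by (rule mdist_cfunspace_le) (use r s(2) in \<open>auto simp: dist_real_def\<close>)
    ultimately show ?thesis using s(1) assms(3) by (auto simp: C.in_mcball simp del: mspace_cfunspace)
  qed
  then show ?thesis
    using assms(3) by (auto simp: mtopology_of_def C.metric_closure_of_alt simp del: mspace_cfunspace)
qed

end
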